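(* Let $(\mathfrak D, A)$ be a Manin pair over a manifold $S$ and let $J:X\to S$ be a Hamiltonian space for $(\mathfrak D, A)$. Then there exists a Lie algebroid action of $A\to S$ on $J:X\to S$.
   Context: Courant algebroid: a vector bundle $E\to S$ with a nondegenerate symmetric bilinear form $(\cdot|\cdot)$, a bundle map (anchor) $\tilde\rho:E\to TS$ and an $\mathbb R$-bilinear (Dorfman) bracket $\circ$ on $\Gamma(E)$ such that, for $e,e_1,e_2,e_3\in\Gamma(E)$ and $f\in C^\infty(S)$: $e_1\circ(e_2\circ e_3)=(e_1\circ e_2)\circ e_3+e_2\circ(e_1\circ e_3)$; $e\circ e=\tfrac12\mathcal D(e|e)$; $\tilde\rho(e)(e_1|e_2)=(e\circ e_1|e_2)+(e_1|e\circ e_2)$; $\tilde\rho(e_1\circ e_2)=[\tilde\rho(e_1),\tilde\rho(e_2)]$; $e_1\circ(fe_2)=f(e_1\circ e_2)+(\tilde\rho(e_1)f)e_2$, where $\mathcal D f\in\Gamma(E)$ is defined by $(\mathcal Df|e)=\tilde\rho(e)f$. Dirac structure in $E\to S$: a subbundle $L\subset E$ that is maximal isotropic (Lagrangian, $L=L^\perp$) with $\Gamma(L)$ closed under $\circ$. It is then a Lie algebroid over $S$ with the restricted bracket $[\![\cdot,\cdot]\!]$ and restricted anchor $\rho$. Manin pair over $S$: a pair $(\mathfrak D,A)$ with $\mathfrak D\to S$ a Courant algebroid and $A\to S$ a Dirac structure in it. For a manifold $X$, $TX\oplus T^*X\to X$ is the standard Courant algebroid: pairing $((X_1,\alpha_1)|(X_2,\alpha_2))=\tfrac12(\alpha_1(X_2)+\alpha_2(X_1))$,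 anchor the first projection, bracket $([X_1,X_2],\mathcal L_{X_1}\alpha_2-i_{X_2}d\alpha_1)$. The product $\mathfrak D\times(TX\oplus T^*X)\to S\times X$ carries the product Courant algebroid structure (sum of pairings and anchors; the bracket extends the two brackets, sections pulled back from different factors having zero bracket). Generalized Dirac structure: given a Courant algebroid $E\to M$ with anchor $\tilde\rho$ and a submanifold $Q\subset M$, it is a Lagrangian subbundle $F\to Q$ of $E|_Q$ such that $\tilde\rho(F)\subset TQ$, and such that $e_1|_Q,e_2|_Q\in\Gamma(F)$ implies $(e_1\circ e_2)|_Q\in\Gamma(F)$ for all sections $e_1,e_2$ of $E$. Hamiltonian space for a Manin pair $(\mathfrak D,A)$ over $S$: a manifold $X$ with a smooth map $J:X\to S$ for which there is a generalized Dirac structure $F\subset E=\mathfrak D\times(TX\oplus T^*X)$ over $Q=\operatorname{graph}J=\{(J(x),x)\}\subset S\times X$ such that (i) $F$ intersects $TX$ (i.e. $\{0\}\times(TX\oplus\{0\})$) trivially; (ii) the intersection of $F$ with $\mathfrak D\times(TX\oplus\{0\})$ projects onto $A$ under the natural projection $E\to\mathfrak D$, i.e. at each $x\in X$ the image in $\mathfrak D_{J(x)}$ is exactly $A_{J(x)}$. Action of a Lie algebroid $(A,[\![\cdot,\cdot]\!],\rho)$ over $S$ on a smooth map $J:X\to S$: an $\mathbb R$-linear map $\Gamma(A)\to\mathfrak X(X)$, $a\mapsto\hat a$, such that $\widehat{fa}=(J^*f)\hat a$, $\widehat{[\![a,b]\!]}=[\hat a,\hat b]$ and $J_*(\hat a(x))=\rho(a(J(x)))$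 for all $f\in C^\infty(S)$, $a,b\in\Gamma(A)$, $x\in X$. *)

theory Defs
  imports "HOL-Analysis.Analysis"
begin

section \<open>Smooth manifolds\<close>

text \<open>Model spaces and fibres are finite-dimensional normed spaces rather than members of the class
  \<open>euclidean_space\<close>, because the latter excludes dimension 0 (for instance a Courant algebroid
  over a point).\<close>

definition finite_dim :: "'v::real_normed_vector itself \<Rightarrow> bool" where
  "finite_dim _ \<longleftrightarrow> (\<exists>B::'v set. finite B \<and> span B = UNIV)"

text \<open>Only used for open \<open>U\<close> and finite-dimensional domain, where it is the usual notion
  of being \<open>k\<close> times continuously differentiable.\<close>

primrec Ck_on ::
  "nat \<Rightarrow> 'a::real_normed_vector set \<Rightarrow> ('a \<Rightarrow> 'b::real_normed_vector) \<Rightarrow> bool" where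
  "Ck_on 0 U f \<longleftrightarrow> continuous_on U f"
| "Ck_on (Suc k) U f \<longleftrightarrow>
     (\<forall>x\<in>U. f differentiable at x) \<and> (\<forall>v. Ck_on k U (\<lambda>x. frechet_derivative f (at x) v))"

definition smooth_on ::
  "'a::real_normed_vector set \<Rightarrow> ('a \<Rightarrow> 'b::real_normed_vector) \<Rightarrow> bool" where
  "smooth_on U f \<longleftrightarrow> (\<forall>k. Ck_on k U f)"

type_synonym ('a, 'e) chart = "'a set \<times> ('a \<Rightarrow> 'e)"

definition chart_inv :: "('a, 'e) chart \<Rightarrow> 'e \<Rightarrow> 'a" where
  "chart_inv c = inv_into (fst c) (snd c)"

definition is_chart :: "('a::topological_space, 'e::real_normed_vector) chart \<Rightarrow> bool" where
  "is_chart c \<longleftrightarrow> open (fst c) \<and> open (snd c ` fst c) \<and>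
     homeomorphism (fst c) (snd c ` fst c) (snd c) (chart_inv c)"

definition smooth_transition ::
  "('a, 'e::real_normed_vector) chart \<Rightarrow> ('a, 'e) chart \<Rightarrow> bool" where
  "smooth_transition c d \<longleftrightarrow> smooth_on (snd c ` (fst c \<inter> fst d)) (snd d \<circ> chart_inv c)"

text \<open>The underlying set of a manifold is its whole point type \<open>'a\<close>, with the topology given by
  the type class; \<open>'e\<close> is the model space. The component \<open>chart_at\<close> selects a chart around each
  point; it is used only to represent tangent vectors: a tangent vector at \<open>p\<close> is given by its
  coordinates in the chart \<open>chart_at M p\<close>, so that every tangent space is a copy of \<open>'e\<close>.
  Coordinates in the other charts are obtained with \<open>tangent_coord\<close> below.\<close>

record ('a, 'e) mfd =
  atlas :: "('a, 'e) chart set"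
  chart_at :: "'a \<Rightarrow> ('a, 'e) chart"

definition smooth_manifold ::
  "('a::{t2_space, second_countable_topology}, 'e::real_normed_vector) mfd \<Rightarrow> bool" where
  "smooth_manifold M \<longleftrightarrow> finite_dim TYPE('e) \<and>
     (\<forall>c\<in>atlas M. is_chart c) \<and>
     (\<forall>c\<in>atlas M. \<forall>d\<in>atlas M. smooth_transition c d) \<and>
     (\<forall>p. chart_at M p \<in> atlas M \<and> p \<in> fst (chart_at M p))"

definition std_mfd :: "('e, 'e) mfd" where
  "std_mfd = \<lparr>atlas = {(UNIV, \<lambda>x. x)}, chart_at = (\<lambda>_. (UNIV, \<lambda>x. x))\<rparr>"

definition prod_chart :: "('a, 'e) chart \<Rightarrow> ('b, 'f) chart \<Rightarrow> ('a \<times> 'b, 'e \<times> 'f) chart" where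
  "prod_chart c d = (fst c \<times> fst d, map_prod (snd c) (snd d))"

definition prod_mfd :: "('a, 'e) mfd \<Rightarrow> ('b, 'f) mfd \<Rightarrow> ('a \<times> 'b, 'e \<times> 'f) mfd" where
  "prod_mfd M N =
     \<lparr>atlas = {prod_chart c d | c d. c \<in> atlas M \<and> d \<in> atlas N},
      chart_at = (\<lambda>p. prod_chart (chart_at M (fst p)) (chart_at N (snd p)))\<rparr>"

text \<open>Smoothness of a map on an open subset \<open>U\<close> of \<open>M\<close>.\<close>

definition smooth_map_on ::
  "('a::topological_space, 'e::real_normed_vector) mfd \<Rightarrow>
   ('b::topological_space, 'f::real_normed_vector) mfd \<Rightarrow> 'a set \<Rightarrow> ('a \<Rightarrow> 'b) \<Rightarrow> bool" where
  "smooth_map_on M N U f \<longleftrightarrow> continuous_on U f \<and>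
     (\<forall>c\<in>atlas M. \<forall>d\<in>atlas N.
        smooth_on (snd c ` (U \<inter> fst c \<inter> f -` fst d)) (snd d \<circ> f \<circ> chart_inv c))"

abbreviation smooth_map ::
  "('a::topological_space, 'e::real_normed_vector) mfd \<Rightarrow>
   ('b::topological_space, 'f::real_normed_vector) mfd \<Rightarrow> ('a \<Rightarrow> 'b) \<Rightarrow> bool" where
  "smooth_map M N f \<equiv> smooth_map_on M N UNIV f"

abbreviation smooth_fun ::
  "('a::topological_space, 'e::real_normed_vector) mfd \<Rightarrow> ('a \<Rightarrow> real) \<Rightarrow> bool" where
  "smooth_fun M f \<equiv> smooth_map M std_mfd f"

definition tangent_map ::
  "('a, 'e::real_normed_vector) mfd \<Rightarrow> ('b, 'f::real_normed_vector) mfd \<Rightarrow>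
   ('a \<Rightarrow> 'b) \<Rightarrow> 'a \<Rightarrow> 'e \<Rightarrow> 'f" where
  "tangent_map M N f p v =
     frechet_derivative (snd (chart_at N (f p)) \<circ> f \<circ> chart_inv (chart_at M p))
       (at (snd (chart_at M p) p)) v"

definition dir_deriv :: "('a, 'e::real_normed_vector) mfd \<Rightarrow> 'a \<Rightarrow> 'e \<Rightarrow> ('a \<Rightarrow> real) \<Rightarrow> real" where
  "dir_deriv M p v f = tangent_map M std_mfd f p v"

text \<open>Embedded submanifolds (described by slice charts of the maximal atlas) and their tangent
  spaces (velocities of smooth curves inside the submanifold).\<close>

definition submanifold ::
  "('a::topological_space, 'e::real_normed_vector) mfd \<Rightarrow> 'a set \<Rightarrow> bool" where
  "submanifold M Q \<longleftrightarrow>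
     (\<exists>k. \<forall>q\<in>Q. \<exists>c W. is_chart c \<and> q \<in> fst c \<and>
        (\<forall>d\<in>atlas M. smooth_transition c d \<and> smooth_transition d c) \<and>
        subspace W \<and> dim W = k \<and> snd c ` (fst c \<inter> Q) = snd c ` fst c \<inter> W)"

definition submanifold_tangent ::
  "('a::topological_space, 'e::real_normed_vector) mfd \<Rightarrow> 'a set \<Rightarrow> 'a \<Rightarrow> 'e set" where
  "submanifold_tangent M Q q =
     {tangent_map (std_mfd :: (real, real) mfd) M g 0 1 | g.
        smooth_map std_mfd M g \<and> g 0 = q \<and> range g \<subseteq> Q}"


section \<open>Vector bundles\<close>

text \<open>The fibre over every base point is a copy of the vector space \<open>'v\<close>; the bundle is given by
  its local trivialisations \<open>(U, t)\<close>, where \<open>t p\<close> maps the fibre over \<open>p \<in> U\<close> to the model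
  space \<open>'v\<close>.\<close>

type_synonym ('a, 'v) vbundle = "('a set \<times> ('a \<Rightarrow> 'v \<Rightarrow> 'v)) set"

definition vector_bundle ::
  "('a::topological_space, 'e::real_normed_vector) mfd \<Rightarrow> ('a, 'v::real_normed_vector) vbundle \<Rightarrow> bool"
where
  "vector_bundle M E \<longleftrightarrow> finite_dim TYPE('v) \<and>
     (\<forall>p. \<exists>(U, t)\<in>E. p \<in> U) \<and>
     (\<forall>(U, t)\<in>E. open U \<and> (\<forall>p\<in>U. linear (t p) \<and> bij (t p))) \<and>
     (\<forall>(U, t)\<in>E. \<forall>(V, u)\<in>E. \<forall>w. smooth_map_on M std_mfd (U \<inter> V) (\<lambda>p. u p (inv (t p) w)))"

definition smooth_section_on ::
  "('a::topological_space, 'e::real_normed_vector) mfd \<Rightarrow> ('a, 'v::real_normed_vector) vbundle \<Rightarrow>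
   'a set \<Rightarrow> ('a \<Rightarrow> 'v) \<Rightarrow> bool" where
  "smooth_section_on M E U \<sigma> \<longleftrightarrow>
     (\<forall>(V, t)\<in>E. smooth_map_on M std_mfd (U \<inter> V) (\<lambda>p. t p (\<sigma> p)))"

definition sections ::
  "('a::topological_space, 'e::real_normed_vector) mfd \<Rightarrow> ('a, 'v::real_normed_vector) vbundle \<Rightarrow>
   ('a \<Rightarrow> 'v) set" where
  "sections M E = {\<sigma>. smooth_section_on M E UNIV \<sigma>}"

definition bundle_map ::
  "('a::topological_space, 'e::real_normed_vector) mfd \<Rightarrow> ('a, 'v::real_normed_vector) vbundle \<Rightarrow>
   ('a, 'w::real_normed_vector) vbundle \<Rightarrow> ('a \<Rightarrow> 'v \<Rightarrow> 'w) \<Rightarrow> bool" where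
  "bundle_map M E E' h \<longleftrightarrow> (\<forall>p. linear (h p)) \<and>
     (\<forall>(U, t)\<in>E. \<forall>v. smooth_section_on M E' U (\<lambda>p. h p (inv (t p) v)))"

definition bundle_metric ::
  "('a::topological_space, 'e::real_normed_vector) mfd \<Rightarrow> ('a, 'v::real_normed_vector) vbundle \<Rightarrow>
   ('a \<Rightarrow> 'v \<Rightarrow> 'v \<Rightarrow> real) \<Rightarrow> bool" where
  "bundle_metric M E g \<longleftrightarrow>
     (\<forall>p. (\<forall>v. linear (g p v)) \<and> (\<forall>v w. g p v w = g p w v) \<and>
          (\<forall>v. (\<forall>w. g p v w = 0) \<longrightarrow> v = 0)) \<and>
     (\<forall>(U, t)\<in>E. \<forall>v w. smooth_map_on M std_mfd U (\<lambda>p. g p (inv (t p) v) (inv (t p) w)))"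

text \<open>A smooth subbundle \<open>F \<rightarrow> Q\<close> of the restriction of \<open>E\<close> to an embedded submanifold \<open>Q\<close>
  (possibly all of \<open>M\<close>). A local frame that is smooth on \<open>Q\<close> is the same as one that extends locally
  to smooth sections of \<open>E\<close>. The values of \<open>F\<close> outside \<open>Q\<close> are irrelevant.\<close>

definition subbundle_over ::
  "('a::topological_space, 'e::real_normed_vector) mfd \<Rightarrow> ('a, 'v::real_normed_vector) vbundle \<Rightarrow>
   'a set \<Rightarrow> ('a \<Rightarrow> 'v set) \<Rightarrow> bool" where
  "subbundle_over M E Q F \<longleftrightarrow>
     (\<exists>k. \<forall>q\<in>Q. \<exists>U f. open U \<and> q \<in> U \<and>
        (\<forall>i<k. smooth_section_on M E U (f i)) \<and>
        (\<forall>p\<in>U \<inter> Q. inj_on (\<lambda>i::nat. f i p) {..<k} \<and>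
           independent ((\<lambda>i. f i p) ` {..<k}) \<and> span ((\<lambda>i. f i p) ` {..<k}) = F p))"

definition direct_sum ::
  "('a, 'v) vbundle \<Rightarrow> ('a, 'w) vbundle \<Rightarrow> ('a, 'v \<times> 'w) vbundle" where
  "direct_sum E E' = {(U \<inter> V, \<lambda>p. map_prod (t p) (u p)) | U t V u. (U, t) \<in> E \<and> (V, u) \<in> E'}"

definition prod_bundle ::
  "('a, 'v) vbundle \<Rightarrow> ('b, 'w) vbundle \<Rightarrow> ('a \<times> 'b, 'v \<times> 'w) vbundle" where
  "prod_bundle E E' =
     {(U \<times> V, \<lambda>p. map_prod (t (fst p)) (u (snd p))) | U t V u. (U, t) \<in> E \<and> (V, u) \<in> E'}"


section \<open>Tangent and cotangent bundle\<close>

definition transition_deriv ::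
  "('a, 'e::real_normed_vector) chart \<Rightarrow> ('a, 'e) chart \<Rightarrow> 'a \<Rightarrow> 'e \<Rightarrow> 'e" where
  "transition_deriv c d p = frechet_derivative (snd d \<circ> chart_inv c) (at (snd c p))"

definition tangent_coord ::
  "('a, 'e::real_normed_vector) mfd \<Rightarrow> ('a, 'e) chart \<Rightarrow> 'a \<Rightarrow> 'e \<Rightarrow> 'e" where
  "tangent_coord M c p = transition_deriv (chart_at M p) c p"

definition cotangent_coord ::
  "('a, 'e::real_normed_vector) mfd \<Rightarrow> ('a, 'e) chart \<Rightarrow> 'a \<Rightarrow> ('e \<Rightarrow>\<^sub>L real) \<Rightarrow> ('e \<Rightarrow>\<^sub>L real)" where
  "cotangent_coord M c p \<alpha> = \<alpha> o\<^sub>L Blinfun (transition_deriv c (chart_at M p) p)"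

definition tangent_bundle :: "('a, 'e::real_normed_vector) mfd \<Rightarrow> ('a, 'e) vbundle" where
  "tangent_bundle M = {(fst c, tangent_coord M c) | c. c \<in> atlas M}"

definition cotangent_bundle :: "('a, 'e::real_normed_vector) mfd \<Rightarrow> ('a, 'e \<Rightarrow>\<^sub>L real) vbundle" where
  "cotangent_bundle M = {(fst c, cotangent_coord M c) | c. c \<in> atlas M}"

abbreviation vector_fields ::
  "('a::topological_space, 'e::real_normed_vector) mfd \<Rightarrow> ('a \<Rightarrow> 'e) set" where
  "vector_fields M \<equiv> sections M (tangent_bundle M)"

text \<open>Coordinate expressions of vector fields and 1-forms near \<open>p\<close> in the chart \<open>chart_at M p\<close>;
  the operations below are given by the usual coordinate formulas in this chart.\<close>

definition local_field ::
  "('a, 'e::real_normed_vector) mfd \<Rightarrow> 'a \<Rightarrow> ('a \<Rightarrow> 'e) \<Rightarrow> 'e \<Rightarrow> 'e" where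
  "local_field M p v z =
     (let c = chart_at M p; q = chart_inv c z in tangent_coord M c q (v q))"

definition local_form ::
  "('a, 'e::real_normed_vector) mfd \<Rightarrow> 'a \<Rightarrow> ('a \<Rightarrow> 'e \<Rightarrow>\<^sub>L real) \<Rightarrow> 'e \<Rightarrow> 'e \<Rightarrow>\<^sub>L real" where
  "local_form M p \<alpha> z =
     (let c = chart_at M p; q = chart_inv c z in cotangent_coord M c q (\<alpha> q))"

definition field_deriv ::
  "('a, 'e::real_normed_vector) mfd \<Rightarrow> 'a \<Rightarrow> ('a \<Rightarrow> 'e) \<Rightarrow> 'e \<Rightarrow> 'e" where
  "field_deriv M p v = frechet_derivative (local_field M p v) (at (snd (chart_at M p) p))"

definition form_deriv ::
  "('a, 'e::real_normed_vector) mfd \<Rightarrow> 'a \<Rightarrow> ('a \<Rightarrow> 'e \<Rightarrow>\<^sub>L real) \<Rightarrow> 'e \<Rightarrow> 'e \<Rightarrow>\<^sub>L real" where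
  "form_deriv M p \<alpha> = frechet_derivative (local_form M p \<alpha>) (at (snd (chart_at M p) p))"

definition lie_bracket ::
  "('a, 'e::real_normed_vector) mfd \<Rightarrow> ('a \<Rightarrow> 'e) \<Rightarrow> ('a \<Rightarrow> 'e) \<Rightarrow> 'a \<Rightarrow> 'e" where
  "lie_bracket M v w p = field_deriv M p w (v p) - field_deriv M p v (w p)"

definition lie_deriv_form ::
  "('a, 'e::real_normed_vector) mfd \<Rightarrow> ('a \<Rightarrow> 'e) \<Rightarrow> ('a \<Rightarrow> 'e \<Rightarrow>\<^sub>L real) \<Rightarrow> 'a \<Rightarrow> 'e \<Rightarrow>\<^sub>L real" where
  "lie_deriv_form M v \<alpha> p =
     form_deriv M p \<alpha> (v p) + (\<alpha> p o\<^sub>L Blinfun (field_deriv M p v))"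

definition ext_deriv ::
  "('a, 'e::real_normed_vector) mfd \<Rightarrow> ('a \<Rightarrow> 'e \<Rightarrow>\<^sub>L real) \<Rightarrow> 'a \<Rightarrow> 'e \<Rightarrow> 'e \<Rightarrow> real" where
  "ext_deriv M \<alpha> p u w =
     blinfun_apply (form_deriv M p \<alpha> u) w - blinfun_apply (form_deriv M p \<alpha> w) u"


section \<open>Courant algebroids, Dirac structures, Manin pairs\<close>

text \<open>Sections are functions \<open>'a \<Rightarrow> 'v\<close>; the bracket is meaningful on smooth sections only.\<close>

record ('a, 'e, 'v) courant =
  cbundle :: "('a, 'v) vbundle"
  pairing :: "'a \<Rightarrow> 'v \<Rightarrow> 'v \<Rightarrow> real"
  anchor :: "'a \<Rightarrow> 'v \<Rightarrow> 'e"
  bracket :: "('a \<Rightarrow> 'v) \<Rightarrow> ('a \<Rightarrow> 'v) \<Rightarrow> ('a \<Rightarrow> 'v)"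

definition courant_D ::
  "('a, 'e::real_normed_vector) mfd \<Rightarrow> ('a, 'e, 'v::real_normed_vector) courant \<Rightarrow>
   ('a \<Rightarrow> real) \<Rightarrow> 'a \<Rightarrow> 'v" where
  "courant_D M C f p = (THE d. \<forall>v. pairing C p d v = dir_deriv M p (anchor C p v) f)"

definition courant_algebroid ::
  "('a::{t2_space, second_countable_topology}, 'e::real_normed_vector) mfd \<Rightarrow>
   ('a, 'e, 'v::real_normed_vector) courant \<Rightarrow> bool" where
  "courant_algebroid M C \<longleftrightarrow>
     smooth_manifold M \<and> vector_bundle M (cbundle C) \<and>
     bundle_metric M (cbundle C) (pairing C) \<and>
     bundle_map M (cbundle C) (tangent_bundle M) (anchor C) \<and>
     (let \<Gamma> = sections M (cbundle C); br = bracket C; \<rho> = anchor C; g = pairing C in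
       (\<forall>a\<in>\<Gamma>. \<forall>b\<in>\<Gamma>. br a b \<in> \<Gamma>) \<and>
       (\<forall>a\<in>\<Gamma>. \<forall>b\<in>\<Gamma>. \<forall>c\<in>\<Gamma>. \<forall>r s.
          br (\<lambda>p. r *\<^sub>R a p + s *\<^sub>R b p) c = (\<lambda>p. r *\<^sub>R br a c p + s *\<^sub>R br b c p) \<and>
          br c (\<lambda>p. r *\<^sub>R a p + s *\<^sub>R b p) = (\<lambda>p. r *\<^sub>R br c a p + s *\<^sub>R br c b p)) \<and>
       (\<forall>a\<in>\<Gamma>. \<forall>b\<in>\<Gamma>. \<forall>c\<in>\<Gamma>. br a (br b c) = (\<lambda>p. br (br a b) c p + br b (br a c) p)) \<and>
       (\<forall>a\<in>\<Gamma>. br a a = (\<lambda>p. (1/2) *\<^sub>R courant_D M C (\<lambda>q. g q (a q) (a q)) p)) \<and>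
       (\<forall>a\<in>\<Gamma>. \<forall>b\<in>\<Gamma>. \<forall>c\<in>\<Gamma>. \<forall>p.
          dir_deriv M p (\<rho> p (a p)) (\<lambda>q. g q (b q) (c q)) =
          g p (br a b p) (c p) + g p (b p) (br a c p)) \<and>
       (\<forall>a\<in>\<Gamma>. \<forall>b\<in>\<Gamma>.
          (\<lambda>p. \<rho> p (br a b p)) = lie_bracket M (\<lambda>p. \<rho> p (a p)) (\<lambda>p. \<rho> p (b p))) \<and>
       (\<forall>a\<in>\<Gamma>. \<forall>b\<in>\<Gamma>. \<forall>f. smooth_fun M f \<longrightarrow>
          br a (\<lambda>p. f p *\<^sub>R b p) =
          (\<lambda>p. f p *\<^sub>R br a b p + dir_deriv M p (\<rho> p (a p)) f *\<^sub>R b p)))"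

definition lagrangian_at :: "('a, 'e, 'v) courant \<Rightarrow> 'a \<Rightarrow> 'v set \<Rightarrow> bool" where
  "lagrangian_at C p L \<longleftrightarrow> L = {v. \<forall>w\<in>L. pairing C p v w = 0}"

definition subbundle_sections ::
  "('a::topological_space, 'e::real_normed_vector) mfd \<Rightarrow> ('a, 'v::real_normed_vector) vbundle \<Rightarrow>
   ('a \<Rightarrow> 'v set) \<Rightarrow> ('a \<Rightarrow> 'v) set" where
  "subbundle_sections M E L = {\<sigma> \<in> sections M E. \<forall>p. \<sigma> p \<in> L p}"

definition dirac_structure ::
  "('a::topological_space, 'e::real_normed_vector) mfd \<Rightarrow>
   ('a, 'e, 'v::real_normed_vector) courant \<Rightarrow> ('a \<Rightarrow> 'v set) \<Rightarrow> bool" where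
  "dirac_structure M C L \<longleftrightarrow>
     subbundle_over M (cbundle C) UNIV L \<and> (\<forall>p. lagrangian_at C p (L p)) \<and>
     (\<forall>a\<in>subbundle_sections M (cbundle C) L. \<forall>b\<in>subbundle_sections M (cbundle C) L.
        bracket C a b \<in> subbundle_sections M (cbundle C) L)"

definition manin_pair ::
  "('a::{t2_space, second_countable_topology}, 'e::real_normed_vector) mfd \<Rightarrow>
   ('a, 'e, 'v::real_normed_vector) courant \<Rightarrow> ('a \<Rightarrow> 'v set) \<Rightarrow> bool" where
  "manin_pair S D A \<longleftrightarrow> courant_algebroid S D \<and> dirac_structure S D A"

definition generalized_dirac ::
  "('a::topological_space, 'e::real_normed_vector) mfd \<Rightarrow>
   ('a, 'e, 'v::real_normed_vector) courant \<Rightarrow> 'a set \<Rightarrow> ('a \<Rightarrow> 'v set) \<Rightarrow> bool" where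
  "generalized_dirac M C Q F \<longleftrightarrow>
     submanifold M Q \<and> subbundle_over M (cbundle C) Q F \<and>
     (\<forall>q\<in>Q. lagrangian_at C q (F q)) \<and>
     (\<forall>q\<in>Q. anchor C q ` F q \<subseteq> submanifold_tangent M Q q) \<and>
     (\<forall>a\<in>sections M (cbundle C). \<forall>b\<in>sections M (cbundle C).
        (\<forall>q\<in>Q. a q \<in> F q) \<and> (\<forall>q\<in>Q. b q \<in> F q) \<longrightarrow> (\<forall>q\<in>Q. bracket C a b q \<in> F q))"


section \<open>The standard Courant algebroid and products\<close>

definition std_courant ::
  "('a, 'e::real_normed_vector) mfd \<Rightarrow> ('a, 'e, 'e \<times> ('e \<Rightarrow>\<^sub>L real)) courant" where
  "std_courant M =
     \<lparr>cbundle = direct_sum (tangent_bundle M) (cotangent_bundle M),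
      pairing = (\<lambda>p (v, \<alpha>) (w, \<beta>). (1/2) * (blinfun_apply \<alpha> w + blinfun_apply \<beta> v)),
      anchor = (\<lambda>p. fst),
      bracket = (\<lambda>a b p.
        (lie_bracket M (fst \<circ> a) (fst \<circ> b) p,
         lie_deriv_form M (fst \<circ> a) (snd \<circ> b) p -
           Blinfun (ext_deriv M (snd \<circ> a) p (fst (b p)))))\<rparr>"

text \<open>Pullbacks to a product base of sections on the two factors.\<close>

definition pull_fst :: "('a \<Rightarrow> 'v) \<Rightarrow> 'a \<times> 'b \<Rightarrow> 'v \<times> 'w::zero" where
  "pull_fst \<sigma> = (\<lambda>(s, x). (\<sigma> s, 0))"

definition pull_snd :: "('b \<Rightarrow> 'w) \<Rightarrow> 'a \<times> 'b \<Rightarrow> 'v::zero \<times> 'w" where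
  "pull_snd \<tau> = (\<lambda>(s, x). (0, \<tau> x))"

text \<open>\<open>E\<close> is the product of the Courant algebroids \<open>C\<close> and \<open>C'\<close>. The bracket of arbitrary sections
  is not written out: pullbacks generate the sections locally over the smooth functions, so it is
  determined on smooth sections by its values on pullbacks and the Courant algebroid axioms.\<close>

definition courant_product ::
  "('a::{t2_space, second_countable_topology}, 'e::real_normed_vector) mfd \<Rightarrow>
   ('a, 'e, 'v::real_normed_vector) courant \<Rightarrow>
   ('b::{t2_space, second_countable_topology}, 'f::real_normed_vector) mfd \<Rightarrow>
   ('b, 'f, 'w::real_normed_vector) courant \<Rightarrow>
   ('a \<times> 'b, 'e \<times> 'f, 'v \<times> 'w) courant \<Rightarrow> bool" where
  "courant_product M C N C' E \<longleftrightarrow>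
     cbundle E = prod_bundle (cbundle C) (cbundle C') \<and>
     pairing E = (\<lambda>(s, x) (v, w) (v', w'). pairing C s v v' + pairing C' x w w') \<and>
     anchor E = (\<lambda>(s, x) (v, w). (anchor C s v, anchor C' x w)) \<and>
     courant_algebroid (prod_mfd M N) E \<and>
     (\<forall>a\<in>sections M (cbundle C). \<forall>b\<in>sections M (cbundle C).
        bracket E (pull_fst a) (pull_fst b) = pull_fst (bracket C a b)) \<and>
     (\<forall>a\<in>sections N (cbundle C'). \<forall>b\<in>sections N (cbundle C').
        bracket E (pull_snd a) (pull_snd b) = pull_snd (bracket C' a b)) \<and>
     (\<forall>a\<in>sections M (cbundle C). \<forall>b\<in>sections N (cbundle C').
        bracket E (pull_fst a) (pull_snd b) = (\<lambda>_. 0) \<and>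
        bracket E (pull_snd b) (pull_fst a) = (\<lambda>_. 0))"


section \<open>Hamiltonian spaces and Lie algebroid actions\<close>

definition graph_of :: "('x \<Rightarrow> 's) \<Rightarrow> ('s \<times> 'x) set" where
  "graph_of J = {(J x, x) | x. True}"

definition hamiltonian_space ::
  "('s::{t2_space, second_countable_topology}, 'm::real_normed_vector) mfd \<Rightarrow>
   ('s, 'm, 'd::real_normed_vector) courant \<Rightarrow> ('s \<Rightarrow> 'd set) \<Rightarrow>
   ('x::{t2_space, second_countable_topology}, 'n::real_normed_vector) mfd \<Rightarrow> ('x \<Rightarrow> 's) \<Rightarrow> bool" where
  "hamiltonian_space S D A X J \<longleftrightarrow>
     smooth_manifold X \<and> smooth_map X S J \<and>
     (\<exists>E F. courant_product S D X (std_courant X) E \<and>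
        generalized_dirac (prod_mfd S X) E (graph_of J) F \<and>
        (\<forall>x. F (J x, x) \<inter> {(0, (v, 0)) | v. True} = {0}) \<and>
        (\<forall>x. fst ` (F (J x, x) \<inter> {(d, (v, 0)) | d v. True}) = A (J x)))"

text \<open>Lie algebroid data on a subbundle \<open>la_fibre\<close> of an ambient vector bundle \<open>la_bundle\<close>; the
  choice \<open>la_fibre = (\<lambda>_. UNIV)\<close> covers Lie algebroids without a given ambient bundle.\<close>

record ('a, 'e, 'v) lie_algebroid =
  la_bundle :: "('a, 'v) vbundle"
  la_fibre :: "'a \<Rightarrow> 'v set"
  la_anchor :: "'a \<Rightarrow> 'v \<Rightarrow> 'e"
  la_bracket :: "('a \<Rightarrow> 'v) \<Rightarrow> ('a \<Rightarrow> 'v) \<Rightarrow> ('a \<Rightarrow> 'v)"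

definition dirac_lie_algebroid ::
  "('a, 'e, 'v) courant \<Rightarrow> ('a \<Rightarrow> 'v set) \<Rightarrow> ('a, 'e, 'v) lie_algebroid" where
  "dirac_lie_algebroid C L =
     \<lparr>la_bundle = cbundle C, la_fibre = L, la_anchor = anchor C, la_bracket = bracket C\<rparr>"

definition la_sections ::
  "('a::topological_space, 'e::real_normed_vector) mfd \<Rightarrow>
   ('a, 'e, 'v::real_normed_vector) lie_algebroid \<Rightarrow> ('a \<Rightarrow> 'v) set" where
  "la_sections S L = subbundle_sections S (la_bundle L) (la_fibre L)"

definition lie_algebroid_action ::
  "('s::topological_space, 'm::real_normed_vector) mfd \<Rightarrow>
   ('s, 'm, 'v::real_normed_vector) lie_algebroid \<Rightarrow>
   ('x::topological_space, 'n::real_normed_vector) mfd \<Rightarrow> ('x \<Rightarrow> 's) \<Rightarrow>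
   (('s \<Rightarrow> 'v) \<Rightarrow> ('x \<Rightarrow> 'n)) \<Rightarrow> bool" where
  "lie_algebroid_action S L X J act \<longleftrightarrow>
     (\<forall>a\<in>la_sections S L. act a \<in> vector_fields X) \<and>
     (\<forall>a\<in>la_sections S L. \<forall>b\<in>la_sections S L. \<forall>r s.
        act (\<lambda>p. r *\<^sub>R a p + s *\<^sub>R b p) = (\<lambda>x. r *\<^sub>R act a x + s *\<^sub>R act b x)) \<and>
     (\<forall>a\<in>la_sections S L. \<forall>f. smooth_fun S f \<longrightarrow>
        act (\<lambda>p. f p *\<^sub>R a p) = (\<lambda>x. f (J x) *\<^sub>R act a x)) \<and>
     (\<forall>a\<in>la_sections S L. \<forall>b\<in>la_sections S L.
        act (la_bracket L a b) = lie_bracket X (act a) (act b)) \<and>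
     (\<forall>a\<in>la_sections S L. \<forall>x.
        tangent_map X S J x (act a x) = la_anchor L (J x) (a (J x)))"

end

theory Submission
  imports Defs
begin

text \<open>
  Let \<open>F\<close> be the generalized Dirac structure of the Hamiltonian space. At each \<open>x\<close> the two conditions on
  \<open>F\<close> say that the vectors of \<open>F\<close> of the form \<open>(d, (v, 0))\<close> are the graph of a linear map from
  \<open>A (J x)\<close> to the tangent space of \<open>X\<close>: the projection to \<open>d\<close> hits exactly \<open>A (J x)\<close>, and \<open>v\<close> is
  determined by \<open>d\<close> because \<open>F\<close> meets the vectors \<open>(0, (v, 0))\<close> trivially. The action sends a section
  \<open>a\<close> of \<open>A\<close> to the field \<open>act a\<close> with \<open>(a (J x), (act a x, 0)) \<in> F (J x, x)\<close>. Uniqueness of \<open>v\<close>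
  turns every membership statement of this form into an equation for \<open>act\<close>, and the axioms of an action
  are read off in this way.

  Linearity over functions holds because the fibres of \<open>F\<close> are subspaces. Compatibility with the
  anchor holds because the anchor maps \<open>F\<close> into the tangent space of the graph of \<open>J\<close>, which
  consists of the pairs \<open>(dJ v, v)\<close> (lemma \<open>tangent_map_graph\<close>). For the bracket, the point is that
  \<open>(a (J x), (act a x, 0))\<close>, which is given on the graph only, is the restriction of the globally
  defined section \<open>(s, x) \<mapsto> (a s, (act a x, 0))\<close>, a sum of sections pulled back from the two factors.
  The product bracket of two such sections is again the sum of the two brackets, and a vector field with
  zero 1-form part has only the Lie bracket as its bracket; so involutivity of \<open>F\<close> gives
  \<open>act (bracket a b) = [act a, act b]\<close> (lemma \<open>act_bracket\<close>).

  What takes work is the smoothness of \<open>act a\<close> (lemma \<open>act_smooth_near\<close>). In trivialisations, the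
  coordinates of \<open>act a x\<close>, together with the coefficients of \<open>(a (J x), (act a x, 0))\<close> in a local
  frame of \<open>F\<close>, solve the linear system
  \<open>(a, (0, 0)) = (\<Sum>i. \<alpha> i *\<^sub>R f i) - (0, (v, 0))\<close>, whose data depend smoothly on \<open>x\<close>. It is
  overdetermined in general, but its columns are independent, again because \<open>F\<close> meets the vectors
  \<open>(0, (v, 0))\<close> trivially. Solutions of such a system are smooth (lemma \<open>smooth_near_coefficients\<close>,
  by Gaussian elimination).
\<close>

section \<open>Finite-dimensional normed spaces\<close>

lemma finite_dim_basis:
  assumes "finite_dim TYPE('v)"
  obtains B :: "'v::real_normed_vector set" where "finite B" "independent B" "span B = UNIV"
proof -
  obtain C :: "'v set" where C: "finite C" "span C = UNIV"
    using assms by (auto simp: finite_dim_def)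
  obtain B where "B \<subseteq> C" "independent B" "C \<subseteq> span B"
    using maximal_independent_subset[of C] by metis
  then show ?thesis
    using C that[of B] finite_subset[of B C] span_mono[of C "span B"] by (auto simp: span_span)
qed

lemma sum_representation:
  assumes "finite B" "independent B" "span B = (UNIV :: 'v::real_vector set)"
  shows "(\<Sum>b\<in>B. representation B v b *\<^sub>R b) = v"
  using assms real_vector.sum_representation_eq[of B v B] by auto

lemma linear_representation:
  assumes "independent B" "span B = (UNIV :: 'v::real_vector set)"
  shows "linear (\<lambda>v. representation B v b)"
  using assms by (intro linearI) (auto simp: representation_add representation_scale)

text \<open>The norm attains a positive minimum on the vectors whose coordinates lie on the unit sphere of
  the sum norm. That sphere is compact by Tychonoff's theorem, since it is closed in a product of
  intervals.\<close>

lemma coordinates_bounded_by_norm: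
  fixes B :: "'v::real_normed_vector set"
  assumes B: "finite B" "independent B"
  obtains m where "m > 0" "\<And>c. m * (\<Sum>b\<in>B. \<bar>c b\<bar>) \<le> norm (\<Sum>b\<in>B. c b *\<^sub>R b)"
proof (cases "B = {}")
  case True
  then show ?thesis using that[of 1] by simp
next
  case False
  \<comment> \<open>The coordinates live in the space of all functions on the type, so those outside \<open>B\<close> are
    pinned to zero; otherwise compactness would fail.\<close>
  define I where "I = (\<lambda>b::'v. if b \<in> B then {-1..1} else {0::real})"
  define K where "K = PiE UNIV I \<inter> {c. (\<Sum>b\<in>B. \<bar>c b\<bar>) = 1}"
  have co: "continuous_on UNIV (\<lambda>c::'v \<Rightarrow> real. c b)" for b
    using continuous_on_product_coordinates by auto
  have "compactin (product_topology (\<lambda>i. euclidean) UNIV) (PiE UNIV I)"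
    by (subst compactin_PiE) (auto simp: I_def)
  then have cI: "compact (PiE UNIV I)"
    by (simp add: euclidean_product_topology)
  have "closed {c::'v \<Rightarrow> real. (\<Sum>b\<in>B. \<bar>c b\<bar>) = 1}"
    by (intro closed_Collect_eq continuous_intros co)
  with cI have cK: "compact K" unfolding K_def by blast
  obtain b0 where b0: "b0 \<in> B" using False by auto
  have "(\<lambda>b. if b = b0 then 1 else 0) \<in> K"
    using b0 B by (auto simp: K_def I_def if_distrib cong: if_cong)
  then have nK: "K \<noteq> {}" by auto
  have "continuous_on K (\<lambda>c. norm (\<Sum>b\<in>B. c b *\<^sub>R b))"
    by (intro continuous_intros continuous_on_subset[OF co]) auto
  then obtain c0 where c0: "c0 \<in> K"
    "\<And>c. c \<in> K \<Longrightarrow> norm (\<Sum>b\<in>B. c0 b *\<^sub>R b) \<le> norm (\<Sum>b\<in>B. c b *\<^sub>R b)"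
    using continuous_attains_inf[OF cK nK] by blast
  define m where "m = norm (\<Sum>b\<in>B. c0 b *\<^sub>R b)"
  have "m \<noteq> 0"
  proof
    assume "m = 0"
    then have "\<forall>b\<in>B. c0 b = 0"
      using independentD[OF B(2) B(1)] by (auto simp: m_def)
    then show False using c0(1) by (auto simp: K_def)
  qed
  then have m: "m > 0" by (simp add: m_def)
  have "m * (\<Sum>b\<in>B. \<bar>c b\<bar>) \<le> norm (\<Sum>b\<in>B. c b *\<^sub>R b)" for c
  proof (cases "(\<Sum>b\<in>B. \<bar>c b\<bar>) = 0")
    case True
    then show ?thesis by simp
  next
    case False
    define r where "r = (\<Sum>b\<in>B. \<bar>c b\<bar>)"
    have r: "r > 0" using False by (simp add: r_def sum_nonneg less_le)
    define d where "d = (\<lambda>b. if b \<in> B then c b / r else 0)"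
    have le: "\<bar>c b\<bar> \<le> r" if "b \<in> B" for b
      unfolding r_def using B that by (intro member_le_sum) auto
    have "(\<Sum>b\<in>B. \<bar>d b\<bar>) = (\<Sum>b\<in>B. \<bar>c b\<bar> / r)"
      using r by (intro sum.cong) (auto simp: d_def)
    also have "\<dots> = 1" using r by (simp add: sum_divide_distrib[symmetric] r_def)
    finally have "d \<in> K"
      using le r by (auto simp: K_def I_def d_def abs_le_iff divide_le_eq le_divide_eq minus_le_iff)
    then have "m \<le> norm (\<Sum>b\<in>B. d b *\<^sub>R b)" using c0(2) by (simp add: m_def)
    also have "(\<Sum>b\<in>B. d b *\<^sub>R b) = (1/r) *\<^sub>R (\<Sum>b\<in>B. c b *\<^sub>R b)"
      by (simp add: scaleR_sum_right d_def)
    finally have "m \<le> norm (\<Sum>b\<in>B. c b *\<^sub>R b) / r" using r by simp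
    then show ?thesis using r by (simp add: r_def[symmetric] pos_le_divide_eq)
  qed
  with m show ?thesis using that by blast
qed

lemma linear_finite_dim_bounded:
  fixes f :: "'v::real_normed_vector \<Rightarrow> 'w::real_normed_vector"
  assumes "finite_dim TYPE('v)" "linear f"
  shows "bounded_linear f"
proof -
  obtain B :: "'v set" where B: "finite B" "independent B" "span B = UNIV"
    using finite_dim_basis[OF assms(1)] by blast
  obtain m where m: "m > 0" "\<And>c. m * (\<Sum>b\<in>B. \<bar>c b\<bar>) \<le> norm (\<Sum>b\<in>B. c b *\<^sub>R b)"
    using coordinates_bounded_by_norm[OF B(1,2)] by blast
  define K where "K = (\<Sum>b\<in>B. norm (f b))"
  have "norm (f v) \<le> norm v * (K / m)" for v
  proof -
    let ?c = "representation B v"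
    have "f v = f (\<Sum>b\<in>B. ?c b *\<^sub>R b)" using sum_representation[OF B] by simp
    also have "\<dots> = (\<Sum>b\<in>B. ?c b *\<^sub>R f b)"
      using assms(2) by (simp add: linear_sum linear_scale)
    finally have "norm (f v) \<le> (\<Sum>b\<in>B. \<bar>?c b\<bar> * norm (f b))"
      using norm_sum[of "\<lambda>b. ?c b *\<^sub>R f b" B] by simp
    also have "\<dots> \<le> (\<Sum>b\<in>B. (\<Sum>b\<in>B. \<bar>?c b\<bar>) * norm (f b))"
      using B(1) by (intro sum_mono mult_right_mono member_le_sum) auto
    also have "\<dots> = (\<Sum>b\<in>B. \<bar>?c b\<bar>) * K" by (simp add: K_def sum_distrib_left)
    also have "\<dots> \<le> (norm v / m) * K"
      using m(1) m(2)[of ?c] sum_representation[OF B, of v]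
      by (intro mult_right_mono) (auto simp: K_def sum_nonneg pos_le_divide_eq mult.commute)
    finally show ?thesis by simp
  qed
  then show ?thesis
    using assms(2) by (intro bounded_linear_intro[where K = "K / m"]) (auto simp: linear_add linear_scale)
qed

lemma exists_functional:
  fixes v :: "'v::real_normed_vector"
  assumes "finite_dim TYPE('v)" "v \<noteq> 0"
  obtains \<phi> :: "'v \<Rightarrow> real" where "bounded_linear \<phi>" "\<phi> v = 1"
proof -
  have "independent {v}" using assms(2) by (simp add: independent_insert)
  then obtain \<phi> :: "'v \<Rightarrow> real" where "linear \<phi>" "\<phi> v = 1"
    using linear_independent_extend[of "{v}" "\<lambda>_. 1"] by auto
  then show ?thesis using that linear_finite_dim_bounded[OF assms(1)] by blast
qed

section \<open>Calculus of smooth functions between normed spaces\<close>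

lemma Ck_on_SucD:
  assumes "Ck_on (Suc k) U f" "x \<in> U"
  shows "(f has_derivative frechet_derivative f (at x)) (at x)"
  using assms frechet_derivative_works by auto

lemma Ck_on_cong:
  assumes "Ck_on k U f" "open U" "\<And>x. x \<in> U \<Longrightarrow> f x = g x"
  shows "Ck_on k U g"
  using assms
proof (induction k arbitrary: f g)
  case 0
  then show ?case by (simp cong: continuous_on_cong)
next
  case (Suc k)
  have d: "(g has_derivative frechet_derivative f (at x)) (at x)" if "x \<in> U" for x
    using Ck_on_SucD[OF Suc.prems(1) that] Suc.prems that
    by (auto intro: has_derivative_transform_within_open)
  have "Ck_on k U (\<lambda>x. frechet_derivative g (at x) v)" for v
  proof (rule Suc.IH[of "\<lambda>x. frechet_derivative f (at x) v"])
    show "Ck_on k U (\<lambda>x. frechet_derivative f (at x) v)" using Suc.prems(1) by simp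
    show "frechet_derivative f (at x) v = frechet_derivative g (at x) v" if "x \<in> U" for x
      by (simp add: frechet_derivative_at[OF d[OF that], symmetric])
  qed (rule Suc.prems(2))
  then show ?case using d by (auto simp: differentiable_def)
qed

lemma Ck_on_SucI:
  assumes "open U" "\<And>x. x \<in> U \<Longrightarrow> (f has_derivative f' x) (at x)"
    "\<And>v. Ck_on k U (\<lambda>x. f' x v)"
  shows "Ck_on (Suc k) U f"
proof -
  have "Ck_on k U (\<lambda>x. frechet_derivative f (at x) v)" for v
    by (rule Ck_on_cong[OF assms(3)[of v] assms(1)])
      (simp add: frechet_derivative_at[OF assms(2), symmetric])
  then show ?thesis using assms(2) by (auto simp: differentiable_def)
qed

lemma Ck_on_subset: "Ck_on k U f \<Longrightarrow> V \<subseteq> U \<Longrightarrow> Ck_on k V f"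
  by (induction k arbitrary: f) (auto intro: continuous_on_subset)

lemma Ck_on_Suc_imp: "Ck_on (Suc k) U f \<Longrightarrow> Ck_on k U f"
proof (induction k arbitrary: f)
  case 0
  then show ?case
    by (auto intro!: continuous_at_imp_continuous_on differentiable_imp_continuous_within)
next
  case (Suc k)
  then show ?case by (metis Ck_on.simps(2))
qed

text \<open>The derivatives are taken at a point of the whole space, so being \<open>k\<close> times continuously
  differentiable is a local property.\<close>

lemma Ck_on_local:
  assumes "\<And>x. x \<in> U \<Longrightarrow> \<exists>V. open V \<and> x \<in> V \<and> Ck_on k V f"
  shows "Ck_on k U f"
  using assms
proof (induction k arbitrary: f)
  case 0
  show ?case
  proof (subst Ck_on.simps, rule continuous_at_imp_continuous_on, rule)
    fix x assume "x \<in> U"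
    then obtain V where "open V" "x \<in> V" "continuous_on V f" using 0 by auto
    then show "isCont f x" by (simp add: continuous_on_eq_continuous_at)
  qed
next
  case (Suc k)
  have "Ck_on k U (\<lambda>x. frechet_derivative f (at x) v)" for v
    using Suc.prems by (intro Suc.IH) (metis Ck_on.simps(2))
  moreover have "f differentiable at x" if "x \<in> U" for x
    using Suc.prems[OF that] by auto
  ultimately show ?case by simp
qed

lemma Ck_on_const: "open U \<Longrightarrow> Ck_on k U (\<lambda>_. c)"
proof (induction k arbitrary: c)
  case (Suc k)
  then show ?case by (intro Ck_on_SucI[where f' = "\<lambda>_ _. 0"]) auto
qed auto

lemma Ck_on_bounded_linear:
  assumes "bounded_linear h" "open U" "Ck_on k U f"
  shows "Ck_on k U (\<lambda>x. h (f x))"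
  using assms(3)
proof (induction k arbitrary: f)
  case 0
  then show ?case by (simp add: bounded_linear.continuous_on[OF assms(1)])
next
  case (Suc k)
  then show ?case
    by (intro Ck_on_SucI[OF assms(2) bounded_linear.has_derivative[OF assms(1) Ck_on_SucD]])
      auto
qed

lemma Ck_on_id: "open U \<Longrightarrow> Ck_on k U (\<lambda>x. x)"
proof (cases k)
  case (Suc n)
  assume "open U"
  then show ?thesis unfolding Suc
    by (intro Ck_on_SucI[where f' = "\<lambda>_ v. v"]) (auto intro: Ck_on_const)
qed auto

lemma Ck_on_add:
  assumes "open U" "Ck_on k U f" "Ck_on k U g"
  shows "Ck_on k U (\<lambda>x. f x + g x)"
  using assms(2,3)
proof (induction k arbitrary: f g)
  case 0
  then show ?case by (simp add: continuous_on_add)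
next
  case (Suc k)
  then show ?case
    by (intro Ck_on_SucI[OF assms(1) has_derivative_add[OF Ck_on_SucD Ck_on_SucD]]) auto
qed

lemma Ck_on_scaleR:
  assumes "open U" "Ck_on k U f" "Ck_on k U g"
  shows "Ck_on k U (\<lambda>x. f x *\<^sub>R g x)"
  using assms(2,3)
proof (induction k arbitrary: f g)
  case 0
  then show ?case by (simp add: continuous_on_scaleR)
next
  case (Suc k)
  have "Ck_on k U (\<lambda>x. f x *\<^sub>R frechet_derivative g (at x) v + frechet_derivative f (at x) v *\<^sub>R g x)" for v
    using Suc by (intro Ck_on_add[OF assms(1)] Suc.IH Ck_on_Suc_imp[OF Suc.prems(1)]
        Ck_on_Suc_imp[OF Suc.prems(2)]) auto
  then show ?case
    by (intro Ck_on_SucI[OF assms(1) has_derivative_scaleR[OF Ck_on_SucD[OF Suc.prems(1)] Ck_on_SucD[OF Suc.prems(2)]]])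
qed

lemma Ck_on_sum:
  assumes "open U" "\<And>i. i \<in> I \<Longrightarrow> Ck_on k U (f i)"
  shows "Ck_on k U (\<lambda>x. \<Sum>i\<in>I. f i x)"
  using assms(2)
  by (induction I rule: infinite_finite_induct) (auto intro: Ck_on_const Ck_on_add assms(1))

text \<open>The derivative of \<open>1/f\<close> in direction \<open>v\<close> is a product of the derivative of \<open>f\<close> with two copies of
  \<open>1/f\<close>, which the induction hypothesis already controls to one order less.\<close>

lemma Ck_on_inverse:
  fixes f :: "'e::real_normed_vector \<Rightarrow> real"
  assumes "open U" "Ck_on k U f" "\<And>x. x \<in> U \<Longrightarrow> f x \<noteq> 0"
  shows "Ck_on k U (\<lambda>x. inverse (f x))"
  using assms(2)
proof (induction k)
  case 0
  then show ?case using assms(3) by (simp add: continuous_on_inverse)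
next
  case (Suc k)
  let ?g = "\<lambda>x. inverse (f x)"
  have "Ck_on k U ?g" using Suc.IH[OF Ck_on_Suc_imp[OF Suc.prems]] .
  then have "Ck_on k U (\<lambda>x. - (?g x *\<^sub>R frechet_derivative f (at x) v *\<^sub>R ?g x))" for v
    using Suc.prems by (intro Ck_on_bounded_linear[OF bounded_linear_minus[OF bounded_linear_ident] assms(1)]
        Ck_on_scaleR[OF assms(1)]) auto
  then show ?case
    using assms(3)
    by (intro Ck_on_SucI[OF assms(1) Deriv.has_derivative_inverse[OF _ Ck_on_SucD[OF Suc.prems]]])
      (auto simp: mult.assoc)
qed

lemma Ck_on_Pair:
  assumes "open U" "Ck_on k U f" "Ck_on k U g"
  shows "Ck_on k U (\<lambda>x. (f x, g x))"
proof -
  have "Ck_on k U (\<lambda>x. (f x, 0) + (0, g x))"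
    by (intro Ck_on_add assms Ck_on_bounded_linear[of "\<lambda>y. (y, 0)"] Ck_on_bounded_linear[of "\<lambda>y. (0, y)"]
        bounded_linear_Pair bounded_linear_ident bounded_linear_zero)
  then show ?thesis by simp
qed

text \<open>Since higher derivatives are formed one direction at a time, the direction in which \<open>g\<close> is
  differentiated must not depend on the point. Expanding \<open>Df(x) v\<close> in a fixed basis of the intermediate
  space turns \<open>Dg(f x)(Df(x) v)\<close> into a finite sum of products of a coordinate of \<open>Df(x) v\<close> with a
  directional derivative of \<open>g\<close> along a basis vector, composed with \<open>f\<close>.\<close>

lemma Ck_on_compose:
  fixes f :: "'e::real_normed_vector \<Rightarrow> 'f::real_normed_vector"
    and g :: "'f \<Rightarrow> 'h::real_normed_vector"
  assumes fin: "finite_dim TYPE('f)" and U: "open U" and "f ` U \<subseteq> V"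
    and "Ck_on k U f" "Ck_on k V g"
  shows "Ck_on k U (\<lambda>x. g (f x))"
proof -
  obtain B :: "'f set" where B: "finite B" "independent B" "span B = UNIV"
    using finite_dim_basis[OF fin] by blast
  have coef: "bounded_linear (\<lambda>v. representation B v b)" for b
    by (intro linear_finite_dim_bounded[OF fin] linear_representation B)
  show ?thesis
    using assms(4,5)
  proof (induction k arbitrary: g)
    case 0
    then show ?case using assms(3) by (auto intro: continuous_on_compose2)
  next
    case (Suc k)
    have D: "((\<lambda>x. g (f x)) has_derivative
        (\<lambda>v. \<Sum>b\<in>B. representation B (frechet_derivative f (at x) v) b *\<^sub>R
            frechet_derivative g (at (f x)) b)) (at x)" if x: "x \<in> U" for x
    proof -
      have dg: "(g has_derivative frechet_derivative g (at (f x))) (at (f x))"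
        using Ck_on_SucD[OF Suc.prems(2)] assms(3) x by auto
      then have lin: "linear (frechet_derivative g (at (f x)))"
        using has_derivative_linear by blast
      have "frechet_derivative g (at (f x)) w =
          (\<Sum>b\<in>B. representation B w b *\<^sub>R frechet_derivative g (at (f x)) b)" for w
        using arg_cong[OF sum_representation[OF B, of w, symmetric],
            of "frechet_derivative g (at (f x))"]
        by (simp add: linear_sum[OF lin] linear_scale[OF lin])
      then have "(\<lambda>v. \<Sum>b\<in>B. representation B (frechet_derivative f (at x) v) b *\<^sub>R
            frechet_derivative g (at (f x)) b) =
          (\<lambda>v. frechet_derivative g (at (f x)) (frechet_derivative f (at x) v))"
        by (intro ext) (rule sym)
      then show ?thesis
        using has_derivative_compose[OF Ck_on_SucD[OF Suc.prems(1) x] dg] by metis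
    qed
    show ?case
    proof (rule Ck_on_SucI[OF U D])
      show "Ck_on k U (\<lambda>x. \<Sum>b\<in>B. representation B (frechet_derivative f (at x) v) b *\<^sub>R
            frechet_derivative g (at (f x)) b)" for v
        using Suc.prems
        by (intro Ck_on_sum[OF U] Ck_on_scaleR[OF U] Ck_on_bounded_linear[OF coef U] Suc.IH
            Ck_on_Suc_imp[OF Suc.prems(1)]) auto
    qed
  qed
qed

section \<open>Smooth functions on a manifold\<close>

lemma chart_inv_left: "is_chart c \<Longrightarrow> x \<in> fst c \<Longrightarrow> chart_inv c (snd c x) = x"
  by (auto simp: is_chart_def homeomorphism_def)

lemma open_chart_image:
  assumes "is_chart c" "open W"
  shows "open (snd c ` (W \<inter> fst c))"
proof -
  have "openin (top_of_set (snd c ` fst c)) (snd c ` (W \<inter> fst c))"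
    using assms by (intro homeomorphism_imp_open_map[of "fst c" _ _ "chart_inv c"])
      (auto simp: is_chart_def openin_open)
  then show ?thesis using assms(1) by (meson is_chart_def openin_open_trans)
qed

lemma smooth_manifold_chart: "smooth_manifold M \<Longrightarrow> c \<in> atlas M \<Longrightarrow> is_chart c"
  by (simp add: smooth_manifold_def)

lemma smooth_map_on_std_mfd:
  "smooth_map_on M std_mfd W f \<longleftrightarrow> continuous_on W f \<and>
     (\<forall>c\<in>atlas M. \<forall>k. Ck_on k (snd c ` (W \<inter> fst c)) (\<lambda>z. f (chart_inv c z)))"
  by (auto simp: smooth_map_on_def std_mfd_def smooth_on_def o_def)

lemma smooth_map_on_subset:
  assumes "smooth_map_on M std_mfd W f" "V \<subseteq> W"
  shows "smooth_map_on M std_mfd V f"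
  using assms unfolding smooth_map_on_std_mfd
  by (auto intro: continuous_on_subset Ck_on_subset)

lemma smooth_map_on_cong:
  assumes "smooth_manifold M" "smooth_map_on M std_mfd W f" "open W"
    "\<And>x. x \<in> W \<Longrightarrow> f x = g x"
  shows "smooth_map_on M std_mfd W g"
  unfolding smooth_map_on_std_mfd
proof (intro conjI ballI allI)
  show "continuous_on W g"
    using assms(2,4) by (simp add: smooth_map_on_std_mfd cong: continuous_on_cong)
  fix c k assume c: "c \<in> atlas M"
  then have ic: "is_chart c" using assms(1) by (rule smooth_manifold_chart[rotated])
  show "Ck_on k (snd c ` (W \<inter> fst c)) (\<lambda>z. g (chart_inv c z))"
  proof (rule Ck_on_cong)
    show "Ck_on k (snd c ` (W \<inter> fst c)) (\<lambda>z. f (chart_inv c z))"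
      using assms(2) c by (simp add: smooth_map_on_std_mfd)
    show "open (snd c ` (W \<inter> fst c))" by (rule open_chart_image[OF ic assms(3)])
    show "f (chart_inv c z) = g (chart_inv c z)" if "z \<in> snd c ` (W \<inter> fst c)" for z
      using that assms(4) chart_inv_left[OF ic] by auto
  qed
qed

text \<open>Being smooth as a germ: smooth coefficients are obtained on neighbourhoods that shrink at each
  elimination step, so the neighbourhood is hidden.\<close>

definition smooth_near ::
  "('a::{t2_space, second_countable_topology}, 'e::real_normed_vector) mfd \<Rightarrow> 'a \<Rightarrow>
   ('a \<Rightarrow> 'b::real_normed_vector) \<Rightarrow> bool" where
  "smooth_near M x f \<longleftrightarrow> (\<exists>W. open W \<and> x \<in> W \<and> smooth_map_on M std_mfd W f)"

lemma smooth_nearI: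
  "smooth_map_on M std_mfd W f \<Longrightarrow> open W \<Longrightarrow> x \<in> W \<Longrightarrow> smooth_near M x f"
  by (auto simp: smooth_near_def)

lemma smooth_near_cong:
  assumes "smooth_manifold M" "smooth_near M x f" "open W" "x \<in> W" "\<And>y. y \<in> W \<Longrightarrow> f y = g y"
  shows "smooth_near M x g"
proof -
  obtain V where V: "open V" "x \<in> V" "smooth_map_on M std_mfd V f"
    using assms(2) by (auto simp: smooth_near_def)
  have "smooth_map_on M std_mfd (V \<inter> W) g"
    by (rule smooth_map_on_cong[OF assms(1) smooth_map_on_subset[OF V(3)]])
      (use V assms in auto)
  then show ?thesis using V assms by (intro smooth_nearI[of _ "V \<inter> W"]) auto
qed

lemma smooth_near_nonzero:
  fixes f :: "'a::{t2_space, second_countable_topology} \<Rightarrow> real"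
  assumes "smooth_near M x f" "f x \<noteq> 0"
  obtains W where "open W" "x \<in> W" "smooth_map_on M std_mfd W f" "\<And>y. y \<in> W \<Longrightarrow> f y \<noteq> 0"
proof -
  obtain V where V: "open V" "x \<in> V" "smooth_map_on M std_mfd V f"
    using assms(1) by (auto simp: smooth_near_def)
  define W where "W = V \<inter> f -` (- {0})"
  have "open W" unfolding W_def
    using V by (intro continuous_open_preimage) (auto simp: smooth_map_on_std_mfd)
  then show ?thesis
    using V assms(2) by (intro that[of W] smooth_map_on_subset[OF V(3)]) (auto simp: W_def)
qed

lemma smooth_map_on_local:
  assumes "smooth_manifold M" "\<And>x. x \<in> U \<Longrightarrow> smooth_near M x f"
  shows "smooth_map_on M std_mfd U f"
  unfolding smooth_map_on_std_mfd
proof (intro conjI ballI allI)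
  show "continuous_on U f"
  proof (rule continuous_at_imp_continuous_on, rule)
    fix x assume "x \<in> U"
    then obtain V where "open V" "x \<in> V" "continuous_on V f"
      using assms(2) unfolding smooth_near_def smooth_map_on_std_mfd by blast
    then show "isCont f x" by (simp add: continuous_on_eq_continuous_at)
  qed
  fix c k assume c: "c \<in> atlas M"
  show "Ck_on k (snd c ` (U \<inter> fst c)) (\<lambda>z. f (chart_inv c z))"
  proof (rule Ck_on_local)
    fix z assume "z \<in> snd c ` (U \<inter> fst c)"
    then obtain x where x: "x \<in> U" "x \<in> fst c" "z = snd c x" by auto
    then obtain V where V: "open V" "x \<in> V" "smooth_map_on M std_mfd V f"
      using assms(2) by (auto simp: smooth_near_def)
    then have "open (snd c ` (V \<inter> fst c))"
      using open_chart_image smooth_manifold_chart[OF assms(1) c] by blast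
    then show "\<exists>V. open V \<and> z \<in> V \<and> Ck_on k V (\<lambda>z. f (chart_inv c z))"
      using V x c by (intro exI[of _ "snd c ` (V \<inter> fst c)"]) (auto simp: smooth_map_on_std_mfd)
  qed
qed

lemma smooth_near_const:
  assumes "smooth_manifold M"
  shows "smooth_near M x (\<lambda>_. v)"
proof (rule smooth_nearI[of _ UNIV])
  show "smooth_map_on M std_mfd UNIV (\<lambda>_. v)"
    using open_chart_image[OF smooth_manifold_chart[OF assms], of _ UNIV]
    by (auto simp: smooth_map_on_std_mfd intro!: Ck_on_const)
qed auto

lemma smooth_map_on_bounded_linear:
  assumes "smooth_manifold M" "open W" "bounded_linear h" "smooth_map_on M std_mfd W f"
  shows "smooth_map_on M std_mfd W (\<lambda>x. h (f x))"
  using assms(4) open_chart_image[OF smooth_manifold_chart[OF assms(1)] assms(2)]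
  by (auto simp: smooth_map_on_std_mfd bounded_linear.continuous_on[OF assms(3)]
      intro!: Ck_on_bounded_linear[OF assms(3)])

lemma smooth_near_bounded_linear:
  assumes "smooth_manifold M" "bounded_linear h" "smooth_near M x f"
  shows "smooth_near M x (\<lambda>x. h (f x))"
  using assms smooth_map_on_bounded_linear unfolding smooth_near_def by blast

lemma smooth_near_common:
  assumes "smooth_near M x f" "smooth_near M x g"
  obtains W where "open W" "x \<in> W" "smooth_map_on M std_mfd W f" "smooth_map_on M std_mfd W g"
proof -
  obtain V U where "open V" "x \<in> V" "smooth_map_on M std_mfd V f"
    "open U" "x \<in> U" "smooth_map_on M std_mfd U g"
    using assms by (auto simp: smooth_near_def)
  then show ?thesis by (intro that[of "V \<inter> U"]) (auto intro: smooth_map_on_subset)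
qed

lemma smooth_near_add:
  assumes "smooth_manifold M" "smooth_near M x f" "smooth_near M x g"
  shows "smooth_near M x (\<lambda>x. f x + g x)"
proof -
  obtain W where W: "open W" "x \<in> W" "smooth_map_on M std_mfd W f" "smooth_map_on M std_mfd W g"
    using smooth_near_common[OF assms(2,3)] by blast
  then have "smooth_map_on M std_mfd W (\<lambda>x. f x + g x)"
    using open_chart_image[OF smooth_manifold_chart[OF assms(1)] W(1)]
    by (auto simp: smooth_map_on_std_mfd intro!: continuous_intros Ck_on_add)
  then show ?thesis using W by (auto simp: smooth_near_def)
qed

lemma smooth_near_scaleR:
  assumes "smooth_manifold M" "smooth_near M x f" "smooth_near M x g"
  shows "smooth_near M x (\<lambda>x. f x *\<^sub>R g x)"
proof -
  obtain W where W: "open W" "x \<in> W" "smooth_map_on M std_mfd W f" "smooth_map_on M std_mfd W g"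
    using smooth_near_common[OF assms(2,3)] by blast
  then have "smooth_map_on M std_mfd W (\<lambda>x. f x *\<^sub>R g x)"
    using open_chart_image[OF smooth_manifold_chart[OF assms(1)] W(1)]
    by (auto simp: smooth_map_on_std_mfd intro!: continuous_intros Ck_on_scaleR)
  then show ?thesis using W by (auto simp: smooth_near_def)
qed

lemma smooth_near_diff:
  assumes "smooth_manifold M" "smooth_near M x f" "smooth_near M x g"
  shows "smooth_near M x (\<lambda>x. f x - g x)"
  using smooth_near_add[OF assms(1,2) smooth_near_bounded_linear[OF assms(1)
      bounded_linear_minus[OF bounded_linear_ident] assms(3)]]
  by simp

lemma smooth_near_sum:
  assumes "smooth_manifold M" "\<And>i. i \<in> I \<Longrightarrow> smooth_near M x (f i)"
  shows "smooth_near M x (\<lambda>x. \<Sum>i\<in>I. f i x)"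
  using assms(2)
  by (induction I rule: infinite_finite_induct)
    (auto intro: smooth_near_const smooth_near_add assms(1))

lemma smooth_near_inverse:
  fixes f :: "'a::{t2_space, second_countable_topology} \<Rightarrow> real"
  assumes "smooth_manifold M" "smooth_near M x f" "f x \<noteq> 0"
  shows "smooth_near M x (\<lambda>x. inverse (f x))"
proof -
  obtain W where W: "open W" "x \<in> W" "smooth_map_on M std_mfd W f" "\<And>y. y \<in> W \<Longrightarrow> f y \<noteq> 0"
    using smooth_near_nonzero[OF assms(2,3)] by blast
  have "Ck_on k (snd c ` (W \<inter> fst c)) (\<lambda>z. inverse (f (chart_inv c z)))" if "c \<in> atlas M" for c k
    using W that chart_inv_left[OF smooth_manifold_chart[OF assms(1) that]]
      open_chart_image[OF smooth_manifold_chart[OF assms(1) that] W(1)]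
    by (intro Ck_on_inverse) (auto simp: smooth_map_on_std_mfd)
  moreover have "continuous_on W (\<lambda>x. inverse (f x))"
    using W by (intro continuous_on_inverse) (auto simp: smooth_map_on_std_mfd)
  ultimately have "smooth_map_on M std_mfd W (\<lambda>x. inverse (f x))"
    by (simp add: smooth_map_on_std_mfd)
  then show ?thesis using W by (auto simp: smooth_near_def)
qed

section \<open>Smooth dependence of coefficients\<close>

text \<open>Gaussian elimination in vector form. Since \<open>h n\<close> does not vanish at \<open>p\<close>, some linear functional
  \<open>\<phi>\<close> is nonzero on it at \<open>p\<close>, hence near \<open>p\<close>; subtracting from each vector the multiple of \<open>h n\<close> that
  kills its value under \<open>\<phi>\<close> removes \<open>h n\<close> from the system and keeps the remaining vectors independent
  at \<open>p\<close>. This works for any number of equations, because \<open>'y\<close> may have dimension larger than the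
  number of unknowns.\<close>

lemma smooth_near_coefficients:
  fixes h :: "'i \<Rightarrow> 'a::{t2_space, second_countable_topology} \<Rightarrow> 'y::real_normed_vector"
  assumes M: "smooth_manifold M" and fin: "finite_dim TYPE('y)"
  assumes "finite I" "\<And>i. i \<in> I \<Longrightarrow> smooth_near M p (h i)" "smooth_near M p y"
    and "open W" "p \<in> W" "\<And>x. x \<in> W \<Longrightarrow> y x = (\<Sum>i\<in>I. \<gamma> i x *\<^sub>R h i x)"
    and "\<And>\<alpha>. (\<Sum>i\<in>I. \<alpha> i *\<^sub>R h i p) = 0 \<Longrightarrow> \<forall>i\<in>I. \<alpha> i = 0"
  shows "\<forall>i\<in>I. smooth_near M p (\<gamma> i)"
  using assms(3-)
proof (induction I arbitrary: h y W rule: finite_induct)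
  case empty
  then show ?case by simp
next
  case (insert n I)
  note hs = insert.prems(1) and ys = insert.prems(2) and W = insert.prems(3,4)
    and eq = insert.prems(5) and ind = insert.prems(6)
  have "h n p \<noteq> 0"
  proof
    assume "h n p = 0"
    then have "(\<Sum>i\<in>insert n I. (if i = n then 1 else 0) *\<^sub>R h i p) = 0"
      using insert.hyps by (auto intro!: sum.neutral)
    from ind[OF this] show False by simp
  qed
  then obtain \<phi> :: "'y \<Rightarrow> real" where \<phi>: "bounded_linear \<phi>" "\<phi> (h n p) = 1"
    using exists_functional[OF fin] by blast
  interpret \<phi>: bounded_linear \<phi> by (rule \<phi>(1))
  define l where "l = (\<lambda>x. \<phi> (h n x))"
  have ls: "smooth_near M p l" unfolding l_def
    using hs by (intro smooth_near_bounded_linear[OF M \<phi>(1)]) simp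
  have lp: "l p = 1" by (simp add: l_def \<phi>)
  then obtain V where V: "open V" "p \<in> V" "\<And>x. x \<in> V \<Longrightarrow> l x \<noteq> 0"
    using smooth_near_nonzero[OF ls] by (metis zero_neq_one)
  \<comment> \<open>The projection onto the kernel of \<open>\<phi>\<close> along \<open>h n x\<close>.\<close>
  define \<pi> where "\<pi> = (\<lambda>x v. v - (\<phi> v *\<^sub>R inverse (l x)) *\<^sub>R h n x)"
  have lin: "linear (\<pi> x)" for x
    by (rule linearI) (simp_all add: \<pi>_def \<phi>.add \<phi>.scaleR algebra_simps)
  have ratio: "smooth_near M p (\<lambda>x. \<phi> (u x) *\<^sub>R inverse (l x))" if "smooth_near M p u" for u
    using smooth_near_scaleR[OF M smooth_near_bounded_linear[OF M \<phi>(1) that]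
        smooth_near_inverse[OF M ls]] lp by simp
  have \<pi>s: "smooth_near M p (\<lambda>x. \<pi> x (u x))" if "smooth_near M p u" for u
    unfolding \<pi>_def
    using smooth_near_diff[OF M that smooth_near_scaleR[OF M ratio[OF that] hs[of n]]] by simp
  have IH: "\<forall>i\<in>I. smooth_near M p (\<gamma> i)"
  proof (rule insert.IH[of "\<lambda>i x. \<pi> x (h i x)" "\<lambda>x. \<pi> x (y x)" "V \<inter> W"])
    show "smooth_near M p (\<lambda>x. \<pi> x (h i x))" if "i \<in> I" for i using that hs by (intro \<pi>s) auto
    show "smooth_near M p (\<lambda>x. \<pi> x (y x))" by (rule \<pi>s[OF ys])
    show "open (V \<inter> W)" "p \<in> V \<inter> W" using V W by auto
    show "\<pi> x (y x) = (\<Sum>i\<in>I. \<gamma> i x *\<^sub>R \<pi> x (h i x))" if "x \<in> V \<inter> W" for x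
    proof -
      have "\<pi> x (h n x) = 0" using V(3) that by (simp add: \<pi>_def l_def)
      then show ?thesis
        using that eq insert.hyps by (simp add: linear_add[OF lin] linear_sum[OF lin] linear_scale[OF lin])
    qed
    show "\<forall>i\<in>I. \<alpha> i = 0" if "(\<Sum>i\<in>I. \<alpha> i *\<^sub>R \<pi> p (h i p)) = 0" for \<alpha>
    proof -
      define s where "s = (\<Sum>i\<in>I. \<alpha> i *\<^sub>R h i p)"
      have "\<pi> p s = 0"
        using that unfolding s_def by (simp add: linear_sum[OF lin] linear_scale[OF lin])
      then have "s - \<phi> s *\<^sub>R h n p = 0" by (simp add: \<pi>_def lp)
      moreover have "(\<Sum>i\<in>insert n I. (\<alpha>(n := - \<phi> s)) i *\<^sub>R h i p) = - \<phi> s *\<^sub>R h n p + s"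
      proof -
        have "(\<Sum>i\<in>I. (\<alpha>(n := - \<phi> s)) i *\<^sub>R h i p) = s"
          unfolding s_def using insert.hyps by (intro sum.cong) auto
        then show ?thesis using insert.hyps by simp
      qed
      \<comment> \<open>A relation among the projected vectors is a relation among the original ones, with
        \<open>- \<phi> s\<close> as the coefficient of \<open>h n\<close>.\<close>
      ultimately have "\<forall>i\<in>insert n I. (\<alpha>(n := - \<phi> s)) i = 0" by (intro ind) simp
      then show ?thesis using insert.hyps by (metis fun_upd_other insertCI)
    qed
  qed
  have "smooth_near M p (\<lambda>x. \<phi> (y x - (\<Sum>i\<in>I. \<gamma> i x *\<^sub>R h i x)) *\<^sub>R inverse (l x))"
    using hs IH by (intro ratio smooth_near_diff[OF M ys] smooth_near_sum[OF M]
        smooth_near_scaleR[OF M]) auto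
  then have "smooth_near M p (\<gamma> n)"
    by (rule smooth_near_cong[OF M, where W = "V \<inter> W"])
      (use V W eq insert.hyps in \<open>auto simp: \<phi>.scaleR l_def\<close>)
  then show ?case using IH by simp
qed

section \<open>Products and graphs\<close>

lemma prod_chart_mem: "c \<in> atlas M \<Longrightarrow> d \<in> atlas N \<Longrightarrow> prod_chart c d \<in> atlas (prod_mfd M N)"
  by (auto simp: prod_mfd_def simp del: split_paired_Ex)

lemma chart_inv_prod_chart:
  assumes "is_chart (prod_chart c d)" "s \<in> fst c" "x \<in> fst d"
  shows "chart_inv (prod_chart c d) (snd c s, snd d x) = (s, x)"
  using chart_inv_left[OF assms(1), of "(s, x)"] assms(2,3) by (simp add: prod_chart_def)

lemma smooth_map_on_prod_fst:
  fixes M :: "('a::{t2_space, second_countable_topology}, 'e::real_normed_vector) mfd"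
    and N :: "('b::{t2_space, second_countable_topology}, 'f::real_normed_vector) mfd"
  assumes P: "smooth_manifold (prod_mfd M N)" and M: "smooth_manifold M"
    and f: "smooth_map_on M std_mfd V f" and "open V" "open W"
  shows "smooth_map_on (prod_mfd M N) std_mfd (V \<times> W) (\<lambda>p. f (fst p))"
  unfolding smooth_map_on_std_mfd
proof (intro conjI ballI allI)
  show "continuous_on (V \<times> W) (\<lambda>p. f (fst p))"
    by (rule continuous_on_compose2[of V f]) (use f in \<open>auto simp: smooth_map_on_std_mfd intro!: continuous_intros\<close>)
  fix e k assume e: "e \<in> atlas (prod_mfd M N)"
  then obtain c d where cd: "e = prod_chart c d" "c \<in> atlas M" "d \<in> atlas N"
    by (auto simp: prod_mfd_def)
  have ie: "is_chart e" and ic: "is_chart c"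
    using smooth_manifold_chart P M e cd by blast+
  let ?U = "snd e ` ((V \<times> W) \<inter> fst e)"
  have U: "open ?U" using assms ie by (intro open_chart_image open_Times)
  have "Ck_on k ?U (\<lambda>z. f (chart_inv c (fst z)))"
  proof (rule Ck_on_compose[where g = "\<lambda>z. f (chart_inv c z)" and V = "snd c ` (V \<inter> fst c)"])
    show "finite_dim TYPE('e)" using M by (simp add: smooth_manifold_def)
    show "Ck_on k ?U fst"
      using Ck_on_bounded_linear[OF bounded_linear_fst U Ck_on_id[OF U]] by simp
    show "Ck_on k (snd c ` (V \<inter> fst c)) (\<lambda>z. f (chart_inv c z))"
      using f cd by (simp add: smooth_map_on_std_mfd)
    show "fst ` ?U \<subseteq> snd c ` (V \<inter> fst c)" by (auto simp: cd prod_chart_def)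
  qed (rule U)
  then show "Ck_on k ?U (\<lambda>z. f (fst (chart_inv e z)))"
  proof (rule Ck_on_cong[OF _ U])
    fix z assume "z \<in> ?U"
    then obtain s x where sx: "s \<in> fst c" "x \<in> fst d" "z = (snd c s, snd d x)"
      by (auto simp: cd prod_chart_def)
    then show "f (chart_inv c (fst z)) = f (fst (chart_inv e z))"
      using chart_inv_prod_chart[of c d s x] ie chart_inv_left[OF ic] by (simp add: cd)
  qed
qed

lemma smooth_map_on_prod_snd:
  fixes M :: "('a::{t2_space, second_countable_topology}, 'e::real_normed_vector) mfd"
    and N :: "('b::{t2_space, second_countable_topology}, 'f::real_normed_vector) mfd"
  assumes P: "smooth_manifold (prod_mfd M N)" and N: "smooth_manifold N"
    and f: "smooth_map_on N std_mfd W f" and "open V" "open W"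
  shows "smooth_map_on (prod_mfd M N) std_mfd (V \<times> W) (\<lambda>p. f (snd p))"
  unfolding smooth_map_on_std_mfd
proof (intro conjI ballI allI)
  show "continuous_on (V \<times> W) (\<lambda>p. f (snd p))"
    by (rule continuous_on_compose2[of W f]) (use f in \<open>auto simp: smooth_map_on_std_mfd intro!: continuous_intros\<close>)
  fix e k assume e: "e \<in> atlas (prod_mfd M N)"
  then obtain c d where cd: "e = prod_chart c d" "c \<in> atlas M" "d \<in> atlas N"
    by (auto simp: prod_mfd_def)
  have ie: "is_chart e" and id: "is_chart d"
    using smooth_manifold_chart P N e cd by blast+
  let ?U = "snd e ` ((V \<times> W) \<inter> fst e)"
  have U: "open ?U" using assms ie by (intro open_chart_image open_Times)
  have "Ck_on k ?U (\<lambda>z. f (chart_inv d (snd z)))"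
  proof (rule Ck_on_compose[where g = "\<lambda>z. f (chart_inv d z)" and V = "snd d ` (W \<inter> fst d)"])
    show "finite_dim TYPE('f)" using N by (simp add: smooth_manifold_def)
    show "Ck_on k ?U snd"
      using Ck_on_bounded_linear[OF bounded_linear_snd U Ck_on_id[OF U]] by simp
    show "Ck_on k (snd d ` (W \<inter> fst d)) (\<lambda>z. f (chart_inv d z))"
      using f cd by (simp add: smooth_map_on_std_mfd)
    show "snd ` ?U \<subseteq> snd d ` (W \<inter> fst d)" by (auto simp: cd prod_chart_def)
  qed (rule U)
  then show "Ck_on k ?U (\<lambda>z. f (snd (chart_inv e z)))"
  proof (rule Ck_on_cong[OF _ U])
    fix z assume "z \<in> ?U"
    then obtain s x where sx: "s \<in> fst c" "x \<in> fst d" "z = (snd c s, snd d x)"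
      by (auto simp: cd prod_chart_def)
    then show "f (chart_inv d (snd z)) = f (snd (chart_inv e z))"
      using chart_inv_prod_chart[of c d s x] ie chart_inv_left[OF id] by (simp add: cd)
  qed
qed

text \<open>The chain rule for \<open>x \<mapsto> (J x, x)\<close>; it serves to restrict sections over a neighbourhood of the
  graph to functions of \<open>x\<close>.\<close>

lemma smooth_near_graph:
  fixes S :: "('a::{t2_space, second_countable_topology}, 'e::real_normed_vector) mfd"
    and X :: "('b::{t2_space, second_countable_topology}, 'f::real_normed_vector) mfd"
  assumes P: "smooth_manifold (prod_mfd S X)" and S: "smooth_manifold S" and X: "smooth_manifold X"
    and J: "smooth_map X S J" and h: "smooth_map_on (prod_mfd S X) std_mfd U h"
    and U: "open U" "(J x0, x0) \<in> U"
  shows "smooth_near X x0 (\<lambda>x. h (J x, x))"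
proof -
  define c where "c = chart_at S (J x0)"
  have c: "c \<in> atlas S" "J x0 \<in> fst c" using S by (auto simp: c_def smooth_manifold_def)
  have ic: "is_chart c" using smooth_manifold_chart[OF S c(1)] .
  have cJ: "continuous_on UNIV J" using J by (simp add: smooth_map_on_def)
  have cG: "continuous_on UNIV (\<lambda>x. (J x, x))" using cJ by (intro continuous_intros)
  define W where "W = (\<lambda>x. (J x, x)) -` U \<inter> J -` fst c"
  have oW: "open W"
    using U ic open_vimage[OF _ cG] open_vimage[OF _ cJ] by (auto simp: W_def is_chart_def)
  have "smooth_map_on X std_mfd W (\<lambda>x. h (J x, x))"
    unfolding smooth_map_on_std_mfd
  proof (intro conjI ballI allI)
    show "continuous_on W (\<lambda>x. h (J x, x))"
    proof (rule continuous_on_compose2[of U h W "\<lambda>x. (J x, x)"])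
      show "continuous_on U h" using h by (simp add: smooth_map_on_std_mfd)
      show "continuous_on W (\<lambda>x. (J x, x))" by (rule continuous_on_subset[OF cG]) simp
    qed (auto simp: W_def)
    fix d k assume d: "d \<in> atlas X"
    have id: "is_chart d" using smooth_manifold_chart[OF X d] .
    define e where "e = prod_chart c d"
    have e: "e \<in> atlas (prod_mfd S X)" unfolding e_def by (rule prod_chart_mem[OF c(1) d])
    have ie: "is_chart e" using smooth_manifold_chart[OF P e] .
    let ?V = "snd d ` (W \<inter> fst d)"
    have oV: "open ?V" by (rule open_chart_image[OF id oW])
    have "Ck_on k ?V (\<lambda>z. h (chart_inv e (snd c (J (chart_inv d z)), z)))"
    proof (rule Ck_on_compose[where g = "\<lambda>z. h (chart_inv e z)" and V = "snd e ` (U \<inter> fst e)"])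
      show "finite_dim TYPE('e \<times> 'f)" using P by (simp add: smooth_manifold_def)
      have "Ck_on k (snd d ` (UNIV \<inter> fst d \<inter> J -` fst c)) (\<lambda>z. snd c (J (chart_inv d z)))"
        using J c(1) d by (simp add: smooth_map_on_def smooth_on_def o_def)
      then show "Ck_on k ?V (\<lambda>z. (snd c (J (chart_inv d z)), z))"
        by (intro Ck_on_Pair[OF oV] Ck_on_id[OF oV]) (auto elim!: Ck_on_subset simp: W_def)
      show "Ck_on k (snd e ` (U \<inter> fst e)) (\<lambda>z. h (chart_inv e z))"
        using h e by (simp add: smooth_map_on_std_mfd)
      show "(\<lambda>z. (snd c (J (chart_inv d z)), z)) ` ?V \<subseteq> snd e ` (U \<inter> fst e)"
      proof
        fix w assume "w \<in> (\<lambda>z. (snd c (J (chart_inv d z)), z)) ` ?V"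
        then obtain x where x: "x \<in> W" "x \<in> fst d" "w = (snd c (J x), snd d x)"
          using chart_inv_left[OF id] by auto
        then show "w \<in> snd e ` (U \<inter> fst e)"
          by (intro image_eqI[of _ _ "(J x, x)"]) (auto simp: e_def prod_chart_def W_def)
      qed
    qed (rule oV)
    then show "Ck_on k ?V (\<lambda>z. h (J (chart_inv d z), chart_inv d z))"
    proof (rule Ck_on_cong[OF _ oV])
      fix z assume "z \<in> ?V"
      then obtain x where x: "x \<in> W" "x \<in> fst d" "z = snd d x" by auto
      then show "h (chart_inv e (snd c (J (chart_inv d z)), z)) = h (J (chart_inv d z), chart_inv d z)"
        using chart_inv_left[OF id] chart_inv_prod_chart[of c d "J x" x] ie
        by (simp add: e_def W_def)
    qed
  qed
  then show ?thesis using oW U c(2) by (intro smooth_nearI) (auto simp: W_def)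
qed

lemma chart_inv_std: "chart_inv (UNIV, \<lambda>x. x) = (\<lambda>x. x)"
  by (auto simp: chart_inv_def fun_eq_iff intro: inv_into_f_f[of "\<lambda>x. x", simplified])

text \<open>A curve in the graph has the form \<open>t \<mapsto> (J (y t), y t)\<close>, so by the chain rule the first component
  of its velocity is the image of the second under the differential of \<open>J\<close>.\<close>

lemma tangent_map_graph:
  fixes S :: "('a::{t2_space, second_countable_topology}, 'e::real_normed_vector) mfd"
    and X :: "('b::{t2_space, second_countable_topology}, 'f::real_normed_vector) mfd"
  assumes P: "smooth_manifold (prod_mfd S X)" and S: "smooth_manifold S" and X: "smooth_manifold X"
    and J: "smooth_map X S J"
    and uv: "(u, v) \<in> submanifold_tangent (prod_mfd S X) (graph_of J) (J x, x)"
  shows "tangent_map X S J x v = u"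
proof -
  obtain g where g: "smooth_map (std_mfd :: (real, real) mfd) (prod_mfd S X) g" "g 0 = (J x, x)"
    "range g \<subseteq> graph_of J" "(u, v) = tangent_map std_mfd (prod_mfd S X) g 0 1"
    using uv by (auto simp: submanifold_tangent_def)
  define c where "c = chart_at S (J x)"
  define d where "d = chart_at X x"
  define e where "e = prod_chart c d"
  have c: "c \<in> atlas S" "J x \<in> fst c" using S by (auto simp: c_def smooth_manifold_def)
  have d: "d \<in> atlas X" "x \<in> fst d" using X by (auto simp: d_def smooth_manifold_def)
  have e: "e \<in> atlas (prod_mfd S X)" unfolding e_def by (rule prod_chart_mem[OF c(1) d(1)])
  have ie: "is_chart e" using smooth_manifold_chart[OF P e] .
  have id: "is_chart d" using smooth_manifold_chart[OF X d(1)] .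
  define G where "G = (\<lambda>t. snd e (g t))"
  have g_graph: "fst (g t) = J (snd (g t))" for t
  proof -
    have "g t \<in> graph_of J" using g(3) by auto
    then show ?thesis by (auto simp: graph_of_def)
  qed
  have G: "G t = (snd c (J (snd (g t))), snd d (snd (g t)))" for t
    by (simp add: G_def e_def prod_chart_def map_prod_def split_beta g_graph)
  have "Ck_on k (g -` fst e) G" for k
    using g(1) e unfolding smooth_map_on_def smooth_on_def std_mfd_def G_def
    by (simp add: chart_inv_std o_def)
  from this[of 1] have "G differentiable (at 0)"
    using g(2) c d by (simp add: e_def prod_chart_def)
  then have dG: "(G has_derivative frechet_derivative G (at 0)) (at 0)"
    by (simp add: frechet_derivative_works)
  have uv': "(u, v) = frechet_derivative G (at 0) 1"
    using g(4,2) by (simp add: tangent_map_def std_mfd_def chart_inv_std o_def G_def prod_mfd_def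
        e_def c_def d_def)
  define H where "H = snd c \<circ> J \<circ> chart_inv d"
  have "Ck_on k (snd d ` (UNIV \<inter> fst d \<inter> J -` fst c)) H" for k
    using J c d by (simp add: smooth_map_on_def smooth_on_def H_def)
  from this[of 1] have "H differentiable (at (snd d x))"
    using c d by simp
  then have dH: "(H has_derivative frechet_derivative H (at (snd d x))) (at (snd d x))"
    by (simp add: frechet_derivative_works)
  have G0: "snd (G 0) = snd d x" by (simp add: G g(2))
  have 1: "((\<lambda>t. fst (G t)) has_derivative (\<lambda>r. fst (frechet_derivative G (at 0) r))) (at 0)"
    by (rule has_derivative_fst[OF dG])
  have "((\<lambda>t. H (snd (G t))) has_derivative
      (\<lambda>r. frechet_derivative H (at (snd d x)) (snd (frechet_derivative G (at 0) r)))) (at 0)"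
    using has_derivative_compose[OF has_derivative_snd[OF dG], of H] dH by (simp add: G0)
  then have 2: "((\<lambda>t. fst (G t)) has_derivative
      (\<lambda>r. frechet_derivative H (at (snd d x)) (snd (frechet_derivative G (at 0) r)))) (at 0)"
  proof (rule has_derivative_transform_within_open)
    have "continuous_on UNIV g" using g(1) by (simp add: smooth_map_on_def)
    then show "open (g -` fst e)" using ie by (auto simp: is_chart_def intro: open_vimage)
    show "0 \<in> g -` fst e" using g(2) c d by (simp add: e_def prod_chart_def)
    show "H (snd (G t)) = fst (G t)" if "t \<in> g -` fst e" for t
      using that chart_inv_left[OF id, of "snd (g t)"]
      by (auto simp: H_def G e_def prod_chart_def mem_Times_iff)
  qed
  have "fst (u, v) = frechet_derivative H (at (snd d x)) (snd (u, v))"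
    using fun_cong[OF has_derivative_unique[OF 1 2], of 1] unfolding uv' .
  then show ?thesis by (simp add: tangent_map_def H_def c_def d_def)
qed

section \<open>Sections of a product bundle\<close>

lemma sections_triv: "\<sigma> \<in> sections M E \<Longrightarrow> (V, t) \<in> E \<Longrightarrow> smooth_map_on M std_mfd V (\<lambda>p. t p (\<sigma> p))"
  by (auto simp: sections_def smooth_section_on_def)

lemma vector_bundle_triv:
  assumes "vector_bundle M E" "(V, t) \<in> E"
  shows "open V" "p \<in> V \<Longrightarrow> linear (t p)" "p \<in> V \<Longrightarrow> inj (t p)"
  using assms by (fastforce simp: vector_bundle_def dest: bij_is_inj)+

lemma vector_bundle_triv_at:
  assumes "vector_bundle M E"
  obtains V t where "(V, t) \<in> E" "p \<in> V"
proof -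
  have "\<exists>(V, t)\<in>E. p \<in> V" using assms by (simp add: vector_bundle_def)
  then show ?thesis using that by auto
qed

lemma sections_add:
  assumes M: "smooth_manifold M" and E: "vector_bundle M E"
    and ab: "a \<in> sections M E" "b \<in> sections M E"
  shows "(\<lambda>p. a p + b p) \<in> sections M E"
proof -
  have "smooth_map_on M std_mfd V (\<lambda>p. t p (a p + b p))" if Vt: "(V, t) \<in> E" for V t
  proof (rule smooth_map_on_cong[OF M])
    show V: "open V" using vector_bundle_triv[OF E Vt] by blast
    show "smooth_map_on M std_mfd V (\<lambda>p. t p (a p) + t p (b p))"
      using sections_triv[OF ab(1) Vt] sections_triv[OF ab(2) Vt] V
      by (intro smooth_map_on_local[OF M] smooth_near_add[OF M]) (auto intro: smooth_nearI)
    show "t p (a p) + t p (b p) = t p (a p + b p)" if "p \<in> V" for p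
      using vector_bundle_triv(2)[OF E Vt that] by (simp add: linear_add)
  qed
  then show ?thesis by (auto simp: sections_def smooth_section_on_def)
qed

lemma prod_bundle_triv:
  "(V, t) \<in> E \<Longrightarrow> (W, u) \<in> E' \<Longrightarrow>
    (V \<times> W, \<lambda>p. map_prod (t (fst p)) (u (snd p))) \<in> prod_bundle E E'"
  unfolding prod_bundle_def by blast

text \<open>The second factor of a product bundle inherits openness and linearity of its trivialisations from
  the product, since one can freeze a point of the first factor. For the bundle \<open>TX \<oplus> T\<^sup>*X\<close> this
  replaces a verification of the bundle axioms by the chain rule for transition maps.\<close>

lemma prod_bundle_second_factor:
  assumes "vector_bundle M E" "vector_bundle (prod_mfd M N) (prod_bundle E E')" "(W, u) \<in> E'"
  shows "open W" "x \<in> W \<Longrightarrow> linear (u x)"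
proof -
  fix s0 :: 'a
  obtain V t where V: "(V, t) \<in> E" "s0 \<in> V"
    by (rule vector_bundle_triv_at[OF assms(1)])
  have mem: "(V \<times> W, \<lambda>p. map_prod (t (fst p)) (u (snd p))) \<in> prod_bundle E E'"
    by (rule prod_bundle_triv[OF V(1) assms(3)])
  have "open (snd ` (V \<times> W))"
    using vector_bundle_triv(1)[OF assms(2) mem] by (rule open_image_snd)
  then show "open W" using V(2) by (auto split: if_splits)
  assume "x \<in> W"
  then have "linear (map_prod (t s0) (u x))"
    using vector_bundle_triv(2)[OF assms(2) mem, of "(s0, x)"] V(2) by simp
  from linear_add[OF this, of "(0, _)" "(0, _)"] linear_scale[OF this, of _ "(0, _)"]
  show "linear (u x)" by (intro linearI) auto
qed

lemma pull_fst_section: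
  fixes M :: "('a::{t2_space, second_countable_topology}, 'e::real_normed_vector) mfd"
    and N :: "('b::{t2_space, second_countable_topology}, 'f::real_normed_vector) mfd"
    and E :: "('a, 'v::real_normed_vector) vbundle" and E' :: "('b, 'w::real_normed_vector) vbundle"
  assumes P: "smooth_manifold (prod_mfd M N)" and M: "smooth_manifold M"
    and E: "vector_bundle M E" and EE: "vector_bundle (prod_mfd M N) (prod_bundle E E')"
    and a: "a \<in> sections M E"
  shows "pull_fst a \<in> sections (prod_mfd M N) (prod_bundle E E')"
proof -
  have "smooth_map_on (prod_mfd M N) std_mfd (V \<times> W)
      (\<lambda>p. map_prod (t (fst p)) (u (snd p)) (pull_fst a p))"
    if Vt: "(V, t) \<in> E" and Wu: "(W, u) \<in> E'" for V t W u
  proof (rule smooth_map_on_cong[OF P])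
    have o: "open V" "open W"
      using vector_bundle_triv(1)[OF E Vt] prod_bundle_second_factor(1)[OF E EE Wu] by auto
    then show VW: "open (V \<times> W)" by (rule open_Times)
    have "bounded_linear (\<lambda>y::'v. (y, 0 :: 'w))"
      by (intro bounded_linear_Pair bounded_linear_ident bounded_linear_zero)
    from smooth_map_on_bounded_linear[OF P VW this
        smooth_map_on_prod_fst[OF P M sections_triv[OF a Vt] o]]
    show "smooth_map_on (prod_mfd M N) std_mfd (V \<times> W) (\<lambda>p. (t (fst p) (a (fst p)), 0 :: 'w))" .
    show "(t (fst p) (a (fst p)), 0) = map_prod (t (fst p)) (u (snd p)) (pull_fst a p)"
      if "p \<in> V \<times> W" for p
      using that linear_0[OF prod_bundle_second_factor(2)[OF E EE Wu]]
      by (auto simp: pull_fst_def)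
  qed
  then show ?thesis by (auto simp: sections_def smooth_section_on_def prod_bundle_def)
qed

lemma pull_snd_section:
  fixes M :: "('a::{t2_space, second_countable_topology}, 'e::real_normed_vector) mfd"
    and N :: "('b::{t2_space, second_countable_topology}, 'f::real_normed_vector) mfd"
    and E :: "('a, 'v::real_normed_vector) vbundle" and E' :: "('b, 'w::real_normed_vector) vbundle"
  assumes P: "smooth_manifold (prod_mfd M N)" and N: "smooth_manifold N"
    and E: "vector_bundle M E" and EE: "vector_bundle (prod_mfd M N) (prod_bundle E E')"
    and a: "a \<in> sections N E'"
  shows "pull_snd a \<in> sections (prod_mfd M N) (prod_bundle E E')"
proof -
  have "smooth_map_on (prod_mfd M N) std_mfd (V \<times> W)
      (\<lambda>p. map_prod (t (fst p)) (u (snd p)) (pull_snd a p))"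
    if Vt: "(V, t) \<in> E" and Wu: "(W, u) \<in> E'" for V t W u
  proof (rule smooth_map_on_cong[OF P])
    have o: "open V" "open W"
      using vector_bundle_triv(1)[OF E Vt] prod_bundle_second_factor(1)[OF E EE Wu] by auto
    then show VW: "open (V \<times> W)" by (rule open_Times)
    have "bounded_linear (\<lambda>y::'w. (0 :: 'v, y))"
      by (intro bounded_linear_Pair bounded_linear_ident bounded_linear_zero)
    from smooth_map_on_bounded_linear[OF P VW this
        smooth_map_on_prod_snd[OF P N sections_triv[OF a Wu] o]]
    show "smooth_map_on (prod_mfd M N) std_mfd (V \<times> W) (\<lambda>p. (0 :: 'v, u (snd p) (a (snd p))))" .
    show "(0, u (snd p) (a (snd p))) = map_prod (t (fst p)) (u (snd p)) (pull_snd a p)"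
      if "p \<in> V \<times> W" for p
      using that linear_0[OF vector_bundle_triv(2)[OF E Vt]]
      by (auto simp: pull_snd_def)
  qed
  then show ?thesis by (auto simp: sections_def smooth_section_on_def prod_bundle_def)
qed

lemma vector_field_zero_form_section:
  assumes X: "smooth_manifold X" and v: "v \<in> vector_fields X"
  shows "(\<lambda>x. (v x, 0)) \<in> sections X (direct_sum (tangent_bundle X) (cotangent_bundle X))"
proof -
  have "smooth_map_on X std_mfd (fst c \<inter> fst d)
      (\<lambda>p. map_prod (tangent_coord X c p) (cotangent_coord X d p) (v p, 0))"
    if c: "c \<in> atlas X" and d: "d \<in> atlas X" for c d
  proof -
    have o: "open (fst c \<inter> fst d)"
      using smooth_manifold_chart[OF X c] smooth_manifold_chart[OF X d] by (auto simp: is_chart_def)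
    have "(fst c, tangent_coord X c) \<in> tangent_bundle X"
      using c unfolding tangent_bundle_def by blast
    from smooth_map_on_subset[OF sections_triv[OF v this]]
    have 1: "smooth_map_on X std_mfd (fst c \<inter> fst d) (\<lambda>p. tangent_coord X c p (v p))" by auto
    have "bounded_linear (\<lambda>y::'b. (y, 0 :: 'b \<Rightarrow>\<^sub>L real))"
      by (intro bounded_linear_Pair bounded_linear_ident bounded_linear_zero)
    from smooth_map_on_bounded_linear[OF X o this 1]
    show ?thesis by (simp add: cotangent_coord_def)
  qed
  then show ?thesis
    by (auto simp: sections_def smooth_section_on_def direct_sum_def tangent_bundle_def
        cotangent_bundle_def)
qed

lemma courant_bracket_add:
  assumes "courant_algebroid M C" "a \<in> sections M (cbundle C)" "b \<in> sections M (cbundle C)"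
    "c \<in> sections M (cbundle C)"
  shows "bracket C (\<lambda>p. a p + b p) c = (\<lambda>p. bracket C a c p + bracket C b c p)"
    "bracket C c (\<lambda>p. a p + b p) = (\<lambda>p. bracket C c a p + bracket C c b p)"
proof -
  have "\<forall>r s. bracket C (\<lambda>p. r *\<^sub>R a p + s *\<^sub>R b p) c = (\<lambda>p. r *\<^sub>R bracket C a c p + s *\<^sub>R bracket C b c p) \<and>
          bracket C c (\<lambda>p. r *\<^sub>R a p + s *\<^sub>R b p) = (\<lambda>p. r *\<^sub>R bracket C c a p + s *\<^sub>R bracket C c b p)"
    using assms unfolding courant_algebroid_def Let_def by blast
  from this[rule_format, of 1 1]
  show "bracket C (\<lambda>p. a p + b p) c = (\<lambda>p. bracket C a c p + bracket C b c p)"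
    "bracket C c (\<lambda>p. a p + b p) = (\<lambda>p. bracket C c a p + bracket C c b p)"
    by simp_all
qed

lemma std_courant_bracket_fields:
  "bracket (std_courant X) (\<lambda>x. (v x, 0)) (\<lambda>x. (w x, 0)) = (\<lambda>x. (lie_bracket X v w x, 0))"
proof -
  have z: "form_deriv X x (\<lambda>_. 0) = (\<lambda>_. 0)" for x
  proof -
    have "local_form X x (\<lambda>_. 0) = (\<lambda>_. 0)"
      by (simp add: fun_eq_iff local_form_def cotangent_coord_def Let_def)
    then show ?thesis by (simp add: form_deriv_def frechet_derivative_const)
  qed
  have "ext_deriv X (\<lambda>_. 0) x u = (\<lambda>_. 0)" for x u
    by (simp add: fun_eq_iff ext_deriv_def z)
  then show ?thesis
    by (simp add: std_courant_def o_def lie_deriv_form_def z zero_blinfun_def[symmetric])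
qed

lemma independent_family:
  fixes f :: "'i \<Rightarrow> 'v::real_vector"
  assumes "finite I" "inj_on f I" "independent (f ` I)" "(\<Sum>i\<in>I. \<alpha> i *\<^sub>R f i) = 0"
  shows "\<forall>i\<in>I. \<alpha> i = 0"
proof
  fix i assume i: "i \<in> I"
  have "(\<Sum>v\<in>f ` I. \<alpha> (inv_into I f v) *\<^sub>R v) = (\<Sum>i\<in>I. \<alpha> i *\<^sub>R f i)"
    using assms(2) by (simp add: sum.reindex)
  then have "\<alpha> (inv_into I f (f i)) = 0"
    using assms i by (intro independentD[OF assms(3), of "f ` I" "\<lambda>v. \<alpha> (inv_into I f v)"]) auto
  then show "\<alpha> i = 0" using assms(2) i by simp
qed

lemma span_family:
  fixes f :: "'i \<Rightarrow> 'v::real_vector"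
  assumes "finite I" "inj_on f I" "v \<in> span (f ` I)"
  obtains \<alpha> where "v = (\<Sum>i\<in>I. \<alpha> i *\<^sub>R f i)"
proof -
  obtain u where "v = (\<Sum>w\<in>f ` I. u w *\<^sub>R w)"
    using assms by (auto simp: span_finite)
  then show ?thesis using assms(2) that[of "\<lambda>i. u (f i)"] by (simp add: sum.reindex)
qed

section \<open>The action defined by a Hamiltonian space\<close>

text \<open>A Hamiltonian space together with a choice of the product Courant algebroid \<open>E\<close> and of the
  generalized Dirac structure \<open>F\<close>, whose existence is all that the definition of a Hamiltonian space
  asserts.\<close>

locale hamiltonian_structure =
  fixes S :: "('s::{t2_space, second_countable_topology}, 'm::real_normed_vector) mfd"
    and D :: "('s, 'm, 'd::real_normed_vector) courant"
    and A :: "'s \<Rightarrow> 'd set"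
    and X :: "('x::{t2_space, second_countable_topology}, 'n::real_normed_vector) mfd"
    and J :: "'x \<Rightarrow> 's"
    and E :: "('s \<times> 'x, 'm \<times> 'n, 'd \<times> 'n \<times> ('n \<Rightarrow>\<^sub>L real)) courant"
    and F :: "'s \<times> 'x \<Rightarrow> ('d \<times> 'n \<times> ('n \<Rightarrow>\<^sub>L real)) set"
  assumes manin: "manin_pair S D A"
    and X: "smooth_manifold X" and J: "smooth_map X S J"
    and product: "courant_product S D X (std_courant X) E"
    and dirac: "generalized_dirac (prod_mfd S X) E (graph_of J) F"
    and transversal: "\<And>x. F (J x, x) \<inter> {(0, (v, 0)) | v. True} = {0}"
    and projection: "\<And>x. fst ` (F (J x, x) \<inter> {(d, (v, 0)) | d v. True}) = A (J x)"
begin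

definition act :: "('s \<Rightarrow> 'd) \<Rightarrow> 'x \<Rightarrow> 'n" where
  "act a x = (THE v. (a (J x), (v, 0)) \<in> F (J x, x))"

abbreviation sectA :: "('s \<Rightarrow> 'd) set" where
  "sectA \<equiv> subbundle_sections S (cbundle D) A"

abbreviation bundleX :: "('x, 'n \<times> ('n \<Rightarrow>\<^sub>L real)) vbundle" where
  "bundleX \<equiv> direct_sum (tangent_bundle X) (cotangent_bundle X)"

lemma S: "smooth_manifold S" and vbD: "vector_bundle S (cbundle D)"
  using manin by (simp_all add: manin_pair_def courant_algebroid_def)

lemma courantE: "courant_algebroid (prod_mfd S X) E"
  and cbundleE: "cbundle E = prod_bundle (cbundle D) bundleX"
  using product by (simp_all add: courant_product_def std_courant_def)

lemma P: "smooth_manifold (prod_mfd S X)"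
  and vbE: "vector_bundle (prod_mfd S X) (prod_bundle (cbundle D) bundleX)"
  using courantE by (simp_all add: courant_algebroid_def cbundleE)

lemma graph_mem: "(J x, x) \<in> graph_of J"
  by (auto simp: graph_of_def)

lemma subspace_F: "subspace (F (J x, x))"
  using dirac graph_mem[of x] unfolding generalized_dirac_def subbundle_over_def
  by (metis IntI subspace_span)

lemma lift_unique:
  assumes "(d, (v, 0)) \<in> F (J x, x)" "(d, (w, 0)) \<in> F (J x, x)"
  shows "v = w"
proof -
  have "(0, (v - w, 0)) \<in> F (J x, x)"
    using subspace_diff[OF subspace_F assms] by simp
  then have "(0, (v - w, 0)) \<in> {0 :: 'd \<times> 'n \<times> ('n \<Rightarrow>\<^sub>L real)}"
    using transversal[of x] by blast
  then show ?thesis by (simp add: zero_prod_def)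
qed

lemma act_eqI: "(a (J x), (v, 0)) \<in> F (J x, x) \<Longrightarrow> act a x = v"
  unfolding act_def by (blast intro: lift_unique)

lemma act_mem:
  assumes "a \<in> sectA"
  shows "(a (J x), (act a x, 0)) \<in> F (J x, x)"
proof -
  have "a (J x) \<in> A (J x)" using assms by (simp add: subbundle_sections_def)
  then obtain v where "(a (J x), (v, 0)) \<in> F (J x, x)"
    unfolding projection[symmetric] by force
  then show ?thesis using act_eqI by metis
qed

lemma act_linear:
  assumes "a \<in> sectA" "b \<in> sectA"
  shows "act (\<lambda>p. r *\<^sub>R a p + s *\<^sub>R b p) = (\<lambda>x. r *\<^sub>R act a x + s *\<^sub>R act b x)"
proof
  fix x
  have "r *\<^sub>R (a (J x), (act a x, 0)) + s *\<^sub>R (b (J x), (act b x, 0)) \<in> F (J x, x)"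
    by (intro subspace_add[OF subspace_F] subspace_scale[OF subspace_F] act_mem assms)
  then show "act (\<lambda>p. r *\<^sub>R a p + s *\<^sub>R b p) x = r *\<^sub>R act a x + s *\<^sub>R act b x"
    by (intro act_eqI) simp
qed

lemma act_scale:
  assumes "a \<in> sectA"
  shows "act (\<lambda>p. f p *\<^sub>R a p) = (\<lambda>x. f (J x) *\<^sub>R act a x)"
proof
  fix x
  have "f (J x) *\<^sub>R (a (J x), (act a x, 0)) \<in> F (J x, x)"
    by (intro subspace_scale[OF subspace_F] act_mem assms)
  then show "act (\<lambda>p. f p *\<^sub>R a p) x = f (J x) *\<^sub>R act a x"
    by (intro act_eqI) simp
qed

lemma tangent_map_act:
  assumes "a \<in> sectA"
  shows "tangent_map X S J x (act a x) = anchor D (J x) (a (J x))"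
proof (rule tangent_map_graph[OF P S X J])
  have "anchor E (J x, x) (a (J x), (act a x, 0)) \<in> submanifold_tangent (prod_mfd S X) (graph_of J) (J x, x)"
    using dirac graph_mem[of x] act_mem[OF assms, of x] unfolding generalized_dirac_def by blast
  then show "(anchor D (J x) (a (J x)), act a x) \<in> submanifold_tangent (prod_mfd S X) (graph_of J) (J x, x)"
    using product by (simp add: courant_product_def std_courant_def)
qed

text \<open>The frame of \<open>F\<close> and the constant fields \<open>(0, (b, 0))\<close>, read in a trivialisation, form an
  independent family at \<open>x0\<close>: a relation between them yields a vector of \<open>F\<close> of the form
  \<open>(0, (v, 0))\<close>, which is zero.
  The known smooth section \<open>(a, (0, 0))\<close> is a combination of this family, and the coefficients of the
  constant fields are the negated coordinates of \<open>act a\<close>.\<close>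

lemma act_smooth_near:
  assumes a: "a \<in> sectA" and c: "c \<in> atlas X" and x0: "x0 \<in> fst c"
  shows "smooth_near X x0 (\<lambda>x. tangent_coord X c x (act a x))"
proof -
  obtain k where "\<forall>q\<in>graph_of J. \<exists>U f. open U \<and> q \<in> U \<and>
        (\<forall>i<k. smooth_section_on (prod_mfd S X) (cbundle E) U (f i)) \<and>
        (\<forall>p\<in>U \<inter> graph_of J. inj_on (\<lambda>i::nat. f i p) {..<k} \<and>
           independent ((\<lambda>i. f i p) ` {..<k}) \<and> span ((\<lambda>i. f i p) ` {..<k}) = F p)"
    using dirac unfolding generalized_dirac_def subbundle_over_def by (elim conjE exE)
  from bspec[OF this graph_mem[of x0]] obtain U f where U: "open U" "(J x0, x0) \<in> U"
    and fs: "\<forall>i<k. smooth_section_on (prod_mfd S X) (cbundle E) U (f i)"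
    and frame: "\<forall>p\<in>U \<inter> graph_of J. inj_on (\<lambda>i::nat. f i p) {..<k} \<and>
           independent ((\<lambda>i. f i p) ` {..<k}) \<and> span ((\<lambda>i. f i p) ` {..<k}) = F p"
    by (elim conjE exE)
  obtain V t where Vt: "(V, t) \<in> cbundle D" "J x0 \<in> V"
    by (rule vector_bundle_triv_at[OF vbD])
  define T where "T = (\<lambda>p. map_prod (t (fst p))
    (map_prod (tangent_coord X c (snd p)) (cotangent_coord X c (snd p))))"
  let ?V = "V \<times> (fst c \<inter> fst c)"
  have "(fst c \<inter> fst c, \<lambda>x. map_prod (tangent_coord X c x) (cotangent_coord X c x)) \<in> bundleX"
    using c unfolding direct_sum_def tangent_bundle_def cotangent_bundle_def by blast
  then have VT: "(?V, T) \<in> prod_bundle (cbundle D) bundleX"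
    unfolding T_def by (rule prod_bundle_triv[OF Vt(1)])
  have oV: "open ?V" and linT: "\<And>p. p \<in> ?V \<Longrightarrow> linear (T p)" and injT: "\<And>p. p \<in> ?V \<Longrightarrow> inj (T p)"
    using vector_bundle_triv[OF vbE VT] by blast+
  define W where "W = (\<lambda>x. (J x, x)) -` (U \<inter> ?V)"
  have "continuous_on UNIV (\<lambda>x. (J x, x))"
    using J by (auto simp: smooth_map_on_def intro!: continuous_intros)
  then have W: "open W" "x0 \<in> W"
    using U oV Vt(2) x0 by (auto simp: W_def intro!: open_vimage)
  obtain B :: "'n set" where B: "finite B" "independent B" "span B = UNIV"
    using X finite_dim_basis by (metis smooth_manifold_def)
  have field_sum: "(\<Sum>b\<in>B. \<beta> b *\<^sub>R (0, (b, 0))) = (0 :: 'd, (\<Sum>b\<in>B. \<beta> b *\<^sub>R b, 0 :: 'n \<Rightarrow>\<^sub>L real))" for \<beta>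
    by (auto simp: prod_eq_iff fst_sum snd_sum)
  have zero_coord: "t (J x) 0 = 0" "tangent_coord X c x 0 = 0" "cotangent_coord X c x 0 = 0"
    if "(J x, x) \<in> ?V" for x
    using linear_0[OF linT[OF that]] by (simp_all add: T_def zero_prod_def)
  have ex: "\<exists>\<alpha>. (a (J x), (act a x, 0)) = (\<Sum>i<k. \<alpha> i *\<^sub>R f i (J x, x))" if "x \<in> W" for x
  proof -
    have "(J x, x) \<in> U \<inter> graph_of J" using that graph_mem by (simp add: W_def)
    from bspec[OF frame this] act_mem[OF a, of x]
    have "inj_on (\<lambda>i. f i (J x, x)) {..<k}"
      "(a (J x), (act a x, 0)) \<in> span ((\<lambda>i. f i (J x, x)) ` {..<k})" by simp_all
    from span_family[OF finite_lessThan this] show ?thesis by blast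
  qed
  from bchoice[OF ballI[OF ex]] obtain \<alpha> where \<alpha>: "\<forall>x\<in>W.
      (a (J x), (act a x, 0)) = (\<Sum>i<k. \<alpha> x i *\<^sub>R f i (J x, x))" ..
  \<comment> \<open>\<open>Inl\<close> indexes the frame of \<open>F\<close>, \<open>Inr\<close> the constant fields.\<close>
  define I where "I = {..<k} <+> B"
  define h where "h = (\<lambda>j x. case j of Inl i \<Rightarrow> T (J x, x) (f i (J x, x)) | Inr b \<Rightarrow> (0, (b, 0)))"
  define \<gamma> where "\<gamma> = (\<lambda>j x. case j of Inl i \<Rightarrow> \<alpha> x i
    | Inr b \<Rightarrow> - representation B (tangent_coord X c x (act a x)) b)"
  have sumI: "(\<Sum>j\<in>I. \<delta> j *\<^sub>R h j x) = T (J x, x) (\<Sum>i<k. \<delta> (Inl i) *\<^sub>R f i (J x, x)) +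
      (0, (\<Sum>b\<in>B. \<delta> (Inr b) *\<^sub>R b, 0))" if "(J x, x) \<in> ?V" for \<delta> x
    using B(1) field_sum[of "\<lambda>b. \<delta> (Inr b)"]
    by (simp add: I_def sum.Plus h_def linear_sum[OF linT[OF that]] linear_scale[OF linT[OF that]])
  have "\<forall>j\<in>I. smooth_near X x0 (\<gamma> j)"
  proof (rule smooth_near_coefficients[OF X])
    show "finite_dim TYPE('d \<times> 'n \<times> ('n \<Rightarrow>\<^sub>L real))" using vbE by (simp add: vector_bundle_def)
    show "finite I" using B(1) by (simp add: I_def)
    show "smooth_near X x0 (h j)" if "j \<in> I" for j
    proof (cases j)
      case (Inl i)
      then have "i < k" using that by (auto simp: I_def)
      from fs[rule_format, OF this] VT have "smooth_map_on (prod_mfd S X) std_mfd (U \<inter> ?V) (\<lambda>p. T p (f i p))"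
        unfolding smooth_section_on_def cbundleE by fast
      from smooth_near_graph[OF P S X J this]
      show ?thesis using Inl U oV Vt(2) x0 by (simp add: h_def open_Int)
    next
      case (Inr b)
      then show ?thesis by (simp add: h_def smooth_near_const[OF X])
    qed
    show "smooth_near X x0 (\<lambda>x. T (J x, x) (pull_fst a (J x, x)))"
    proof (rule smooth_near_graph[OF P S X J _ oV])
      have "a \<in> sections S (cbundle D)" using a by (simp add: subbundle_sections_def)
      then show "smooth_map_on (prod_mfd S X) std_mfd ?V (\<lambda>p. T p (pull_fst a p))"
        by (rule sections_triv[OF pull_fst_section[OF P S vbD vbE] VT])
    qed (use Vt x0 in auto)
    show "open W" "x0 \<in> W" by (fact W)+
    show "T (J x, x) (pull_fst a (J x, x)) = (\<Sum>j\<in>I. \<gamma> j x *\<^sub>R h j x)" if x: "x \<in> W" for x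
    proof -
      have V: "(J x, x) \<in> ?V" using x by (simp add: W_def)
      have "(\<Sum>b\<in>B. \<gamma> (Inr b) x *\<^sub>R b) = - tangent_coord X c x (act a x)"
        using sum_representation[OF B, of "tangent_coord X c x (act a x)"]
        by (simp add: \<gamma>_def sum_negf)
      then show ?thesis
        using bspec[OF \<alpha> x, symmetric] zero_coord[OF V]
        by (simp add: sumI[OF V] \<gamma>_def pull_fst_def T_def zero_prod_def)
    qed
    show "\<forall>j\<in>I. \<delta> j = 0" if \<delta>: "(\<Sum>j\<in>I. \<delta> j *\<^sub>R h j x0) = 0" for \<delta>
    proof -
      have V: "(J x0, x0) \<in> ?V" using W by (simp add: W_def)
      have q: "(J x0, x0) \<in> U \<inter> graph_of J" using U graph_mem by simp
      note fr = bspec[OF frame q]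
      define e where "e = (\<Sum>i<k. \<delta> (Inl i) *\<^sub>R f i (J x0, x0))"
      define w where "w = (\<Sum>b\<in>B. \<delta> (Inr b) *\<^sub>R b)"
      have Te: "T (J x0, x0) e + (0, (w, 0)) = 0"
        using \<delta> by (simp add: sumI[OF V] e_def w_def)
      have "e \<in> span ((\<lambda>i. f i (J x0, x0)) ` {..<k})"
        unfolding e_def by (intro span_sum span_scale span_base) auto
      then have eF: "e \<in> F (J x0, x0)" using fr by simp
      obtain d v \<eta> where e: "e = (d, (v, \<eta>))" by (cases e) auto
      have "T (J x0, x0) e = T (J x0, x0) (0, (v, 0))"
        using Te zero_coord[OF V] by (simp add: T_def e zero_prod_def)
      then have e': "e = (0, (v, 0))" using injD[OF injT[OF V]] by blast
      then have "e \<in> F (J x0, x0) \<inter> {(0, (v, 0)) | v. True}" using eF by blast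
      then have e0: "e = 0" using transversal[of x0] by blast
      have "T (J x0, x0) e = 0" using linear_0[OF linT[OF V]] by (simp add: e0)
      then have "w = 0" using Te by (simp add: zero_prod_def)
      then have "\<forall>b\<in>B. \<delta> (Inr b) = 0"
        using independentD[OF B(2) B(1) subset_refl, of "\<lambda>b. \<delta> (Inr b)"] by (simp add: w_def)
      moreover have "\<forall>i\<in>{..<k}. \<delta> (Inl i) = 0"
        using fr e0 by (intro independent_family[of _ "\<lambda>i. f i (J x0, x0)"]) (auto simp: e_def)
      ultimately show ?thesis by (auto simp: I_def)
    qed
  qed
  then have "smooth_near X x0 (\<lambda>x. \<Sum>b\<in>B. \<gamma> (Inr b) x *\<^sub>R b)"
    by (intro smooth_near_sum[OF X] smooth_near_scaleR[OF X] smooth_near_const[OF X])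
      (auto simp: I_def)
  from smooth_near_bounded_linear[OF X bounded_linear_minus[OF bounded_linear_ident] this]
  show ?thesis
    by (simp add: \<gamma>_def sum_negf sum_representation[OF B])
qed

lemma act_vector_field:
  assumes "a \<in> sectA"
  shows "act a \<in> vector_fields X"
  using smooth_map_on_local[OF X act_smooth_near[OF assms]]
  by (auto simp: sections_def smooth_section_on_def tangent_bundle_def)

text \<open>The section \<open>lift a\<close> of \<open>E\<close> extends \<open>(a (J x), (act a x, 0))\<close> from the graph to the whole product
  and has a computable bracket; its mixed terms vanish because sections pulled back from different
  factors commute.\<close>

lemma act_bracket:
  assumes a: "a \<in> sectA" and b: "b \<in> sectA"
  shows "act (bracket D a b) = lie_bracket X (act a) (act b)"
proof
  fix x
  define lift where "lift = (\<lambda>a p. pull_fst a p + pull_snd (\<lambda>x. (act a x, 0 :: 'n \<Rightarrow>\<^sub>L real)) p)"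
  have D_sec: "a \<in> sections S (cbundle D)" if "a \<in> sectA" for a
    using that by (simp add: subbundle_sections_def)
  have X_sec: "(\<lambda>x. (act a x, 0)) \<in> sections X bundleX" if "a \<in> sectA" for a
    by (rule vector_field_zero_form_section[OF X act_vector_field[OF that]])
  have pf: "pull_fst a \<in> sections (prod_mfd S X) (cbundle E)" if "a \<in> sectA" for a
    unfolding cbundleE by (rule pull_fst_section[OF P S vbD vbE D_sec[OF that]])
  have ps: "pull_snd (\<lambda>x. (act a x, 0)) \<in> sections (prod_mfd S X) (cbundle E)" if "a \<in> sectA" for a
    unfolding cbundleE by (rule pull_snd_section[OF P X vbD vbE X_sec[OF that]])
  have lift_sec: "lift a \<in> sections (prod_mfd S X) (cbundle E)" if "a \<in> sectA" for a
    using sections_add[OF P _ pf[OF that] ps[OF that]] vbE by (simp add: lift_def cbundleE)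
  have lift_F: "\<forall>q\<in>graph_of J. lift a q \<in> F q" if "a \<in> sectA" for a
    using act_mem[OF that] by (auto simp: graph_of_def lift_def pull_fst_def pull_snd_def)
  have "bracket E (lift a) (lift b) (J x, x) \<in> F (J x, x)"
    using dirac lift_sec[OF a] lift_sec[OF b] lift_F[OF a] lift_F[OF b] graph_mem[of x]
    unfolding generalized_dirac_def by blast
  moreover have "bracket E (lift a) (lift b) =
      (\<lambda>p. pull_fst (bracket D a b) p + pull_snd (\<lambda>x. (lie_bracket X (act a) (act b) x, 0)) p)"
  proof -
    have cbX: "cbundle (std_courant X) = bundleX" by (simp add: std_courant_def)
    have ff: "bracket E (pull_fst a) (pull_fst b) = pull_fst (bracket D a b)"
      and ss: "bracket E (pull_snd (\<lambda>x. (act a x, 0))) (pull_snd (\<lambda>x. (act b x, 0))) =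
          pull_snd (bracket (std_courant X) (\<lambda>x. (act a x, 0)) (\<lambda>x. (act b x, 0)))"
      and fs: "bracket E (pull_fst a) (pull_snd (\<lambda>x. (act b x, 0))) = (\<lambda>_. 0)"
      and sf: "bracket E (pull_snd (\<lambda>x. (act a x, 0))) (pull_fst b) = (\<lambda>_. 0)"
      using product D_sec[OF a] D_sec[OF b] X_sec[OF a] X_sec[OF b]
      unfolding courant_product_def cbX by blast+
    show ?thesis
      unfolding lift_def
        courant_bracket_add(1)[OF courantE pf[OF a] ps[OF a] lift_sec[OF b, unfolded lift_def]]
        courant_bracket_add(2)[OF courantE pf[OF b] ps[OF b] pf[OF a]]
        courant_bracket_add(2)[OF courantE pf[OF b] ps[OF b] ps[OF a]]
        ff ss fs sf std_courant_bracket_fields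
      by simp
  qed
  ultimately have "(bracket D a b (J x), (lie_bracket X (act a) (act b) x, 0)) \<in> F (J x, x)"
    by (simp add: pull_fst_def pull_snd_def)
  then show "act (bracket D a b) x = lie_bracket X (act a) (act b) x"
    by (rule act_eqI)
qed

lemma act_lie_algebroid_action: "lie_algebroid_action S (dirac_lie_algebroid D A) X J act"
  by (simp add: lie_algebroid_action_def la_sections_def dirac_lie_algebroid_def act_vector_field
      act_linear act_scale act_bracket tangent_map_act)

end

theorem proposition3p3:
  fixes S :: "('s::{t2_space, second_countable_topology}, 'm::real_normed_vector) mfd"
    and D :: "('s, 'm, 'd::real_normed_vector) courant"
    and A :: "'s \<Rightarrow> 'd set"
    and X :: "('x::{t2_space, second_countable_topology}, 'n::real_normed_vector) mfd"
    and J :: "'x \<Rightarrow> 's"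
  assumes "manin_pair S D A"
    and "hamiltonian_space S D A X J"
  shows "\<exists>act. lie_algebroid_action S (dirac_lie_algebroid D A) X J act"
proof -
  obtain E F where "hamiltonian_structure S D A X J E F"
    using assms unfolding hamiltonian_space_def hamiltonian_structure_def by blast
  then show ?thesis using hamiltonian_structure.act_lie_algebroid_action by blast
qed

end
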